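(* Let $\Bbbk$ be a field of characteristic zero and let $n\ge 1$ be an integer. Let $E_n$ be the set consisting of the following elements of $R_n=\Bbbk[x_0,\ldots,x_n]$: (i) $f_0,f_1,\ldots,f_{[n/2]}$; (ii) $\epsilon_{s_0}(x_2),\ldots,\epsilon_{s_0}(x_n)$; (iii) for each $m$ with $1\le m\le [\frac{n-1}{2}]$, the elements $\epsilon_{s_m}(x_m),\epsilon_{s_m}(x_{m+1}),\ldots,\epsilon_{s_m}(x_n)$; (iv) if $n\equiv 0 \bmod 4$, additionally one extra invariant $w\in A_n$ satisfying $\pi_{n/2,n}(w)=x_0^3$ (such a $w$ exists). Then $E_n$ is a separating set for $A_n$; that is, $E_n\subseteq A_n$, and for all $v,v'\in V_n=\Bbbk^{n+1}$, if there exists $f\in A_n$ with $f(v)\ne f(v')$, then there exists $s\in E_n$ with $s(v)\neq s(v')$.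
   Context: $\Bbbk$ is a field of characteristic zero and $[x]$ denotes the largest integer $\le x$. $R_n:=\Bbbk[x_0,\ldots,x_n]$ is the polynomial ring, regarded as the ring of polynomial functions on $V_n=\Bbbk^{n+1}$ with coordinate functions $x_0,\ldots,x_n$. The Weitzenböck derivation is $$D_n:=x_0\frac{\partial}{\partial x_1}+\ldots+x_{n-1}\frac{\partial}{\partial x_n}$$ on $R_n$. The additive group $\mathbb{G}_a$ of $\Bbbk$ acts on $R_n$ by $a*f=\exp(aD_n)f$ (the basic action), and the ring of invariants is $A_n:=\ker D_n$. Define $f_0:=x_0$ and, for $m=1,\ldots,[\frac n2]$, $$f_m:=\sum_{k=0}^{m-1}(-1)^k x_kx_{2m-k}+\tfrac12(-1)^m x_m^2\in A_n .$$ Define $s_0:=x_1$ and, for $m=1,\ldots,[\frac{n-1}{2}]$, $$s_m:=\sum_{k=0}^m(-1)^k\frac{2m+1-2k}{2}x_kx_{2m+1-k}\in R_n .$$ These satisfy $D_ns_m=f_m\in A_n\setminus\{0\}$ for all $m$. For $a\in R_n\setminus\{0\}$ let $\nu(a):=\min\{m\in\mathbb{N}: D_n^{m+1}(a)=0\}$ (with $0\in\mathbb N$). For $s\in R_n$ with $D_ns\in A_n\setminus\{0\}$ (a local slice) and $a\in R_n\setminus\{0\}$ put $$\epsilon_s(a):=\sum_{k=0}^{\nu(a)}\frac{(-1)^k}{k!}(D_n^ka)\,s^k\,(D_ns)^{\nu(a)-k}\in A_n .$$ For $0\le m<n$, $\pi_{m,n}:R_n\to R_m$ is the $\Bbbk$-algebra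 homomorphism $f(x_0,\ldots,x_n)\mapsto f(0,\ldots,0,x_0,\ldots,x_m)$ with $n-m$ zeros, i.e. $x_i\mapsto 0$ for $i<n-m$ and $x_{n-m+j}\mapsto x_j$ for $0\le j\le m$. *)

theory Defs
  imports "HOL-Library.Poly_Mapping" "HOL-Library.FuncSet"
begin

text \<open>Polynomials in the countably many variables \<open>x\<^sub>0, x\<^sub>1, \<dots>\<close>: finitely supported maps from
  monomials (exponent vectors) to coefficients, with the convolution product of
  \<^theory>\<open>HOL-Library.Poly_Mapping\<close>. The ring \<open>R\<^sub>n\<close> is the subring \<open>Rn n\<close> of those
  polynomials that involve only \<open>x\<^sub>0, \<dots>, x\<^sub>n\<close>.\<close>

type_synonym 'a mpol = "(nat \<Rightarrow>\<^sub>0 nat) \<Rightarrow>\<^sub>0 'a"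

definition Const :: "'a::zero \<Rightarrow> 'a mpol" where
  "Const c = Poly_Mapping.single 0 c"

definition Var :: "nat \<Rightarrow> 'a::zero_neq_one mpol" where
  "Var i = Poly_Mapping.single (Poly_Mapping.single i 1) 1"

definition Rn :: "nat \<Rightarrow> 'a::zero mpol set" where
  "Rn n = {p. \<forall>\<mu> \<in> Poly_Mapping.keys p. Poly_Mapping.keys \<mu> \<subseteq> {..n}}"

text \<open>The homomorphism applying \<open>h\<close> to the coefficients and sending \<open>x\<^sub>i\<close> to \<open>\<sigma> i\<close>.\<close>

definition subst_hom :: "('a::zero \<Rightarrow> 'b::comm_semiring_1) \<Rightarrow> (nat \<Rightarrow> 'b) \<Rightarrow> 'a mpol \<Rightarrow> 'b" where
  "subst_hom h \<sigma> p =
     (\<Sum>\<mu> \<in> Poly_Mapping.keys p. h (Poly_Mapping.lookup p \<mu>) *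
        (\<Prod>i \<in> Poly_Mapping.keys \<mu>. \<sigma> i ^ Poly_Mapping.lookup \<mu> i))"

definition eval_at :: "(nat \<Rightarrow> 'a::comm_semiring_1) \<Rightarrow> 'a mpol \<Rightarrow> 'a" where
  "eval_at v = subst_hom (\<lambda>c. c) v"

text \<open>Points of \<open>\<bbbk>\<^sup>n\<^sup>+\<^sup>1\<close> are families indexed by \<open>{0..n}\<close> (and \<open>undefined\<close> elsewhere).\<close>

definition Vn :: "nat \<Rightarrow> (nat \<Rightarrow> 'a) set" where
  "Vn n = ({0..n} \<rightarrow>\<^sub>E UNIV)"

text \<open>In \<open>pdiff\<close>, the exponent subtraction truncates only when the coefficient is zero anyway.\<close>

definition pdiff :: "nat \<Rightarrow> 'a::semiring_1 mpol \<Rightarrow> 'a mpol" where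
  "pdiff i p =
     (\<Sum>\<mu> \<in> Poly_Mapping.keys p. Poly_Mapping.single (\<mu> - Poly_Mapping.single i 1)
        (of_nat (Poly_Mapping.lookup \<mu> i) * Poly_Mapping.lookup p \<mu>))"

definition weitz :: "nat \<Rightarrow> 'a::field_char_0 mpol \<Rightarrow> 'a mpol" where
  "weitz n p = (\<Sum>i = 1..n. Var (i - 1) * pdiff i p)"

definition An :: "nat \<Rightarrow> 'a::field_char_0 mpol set" where
  "An n = {p \<in> Rn n. weitz n p = 0}"

definition f_inv :: "nat \<Rightarrow> 'a::field_char_0 mpol" where
  "f_inv m = (if m = 0 then Var 0
     else (\<Sum>k = 0..m - 1. (- 1) ^ k * Var k * Var (2 * m - k))
        + Const (1 / 2) * (- 1) ^ m * Var m ^ 2)"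

definition s_slice :: "nat \<Rightarrow> 'a::field_char_0 mpol" where
  "s_slice m = (if m = 0 then Var 1
     else (\<Sum>k = 0..m. (- 1) ^ k * Const (of_nat (2 * m + 1 - 2 * k) / 2)
        * Var k * Var (2 * m + 1 - k)))"

text \<open>\<open>weitz n\<close> is locally nilpotent on \<open>R\<^sub>n\<close>, so the minimum exists there.\<close>

definition nu :: "nat \<Rightarrow> 'a::field_char_0 mpol \<Rightarrow> nat" where
  "nu n a = (LEAST m. (weitz n ^^ (m + 1)) a = 0)"

definition eps :: "nat \<Rightarrow> 'a::field_char_0 mpol \<Rightarrow> 'a mpol \<Rightarrow> 'a mpol" where
  "eps n s a = (\<Sum>k = 0..nu n a. Const ((- 1) ^ k / fact k) * (weitz n ^^ k) a
      * s ^ k * weitz n s ^ (nu n a - k))"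

definition proj :: "nat \<Rightarrow> nat \<Rightarrow> 'a::field_char_0 mpol \<Rightarrow> 'a mpol" where
  "proj m n = subst_hom Const (\<lambda>i. if i < n - m then 0 else Var (i - (n - m)))"

text \<open>The set \<open>E\<^sub>n\<close> depends on the choice of \<open>w\<close>, which is used only if 4 divides \<open>n\<close>.\<close>

definition is_extra :: "nat \<Rightarrow> 'a::field_char_0 mpol \<Rightarrow> bool" where
  "is_extra n w \<longleftrightarrow> w \<in> An n \<and> proj (n div 2) n w = Var 0 ^ 3"

definition En :: "nat \<Rightarrow> 'a::field_char_0 mpol \<Rightarrow> 'a mpol set" where
  "En n w = {f_inv m | m. m \<le> n div 2}
     \<union> {eps n (s_slice 0) (Var i) | i. 2 \<le> i \<and> i \<le> n}
     \<union> {eps n (s_slice m) (Var i) | m i. 1 \<le> m \<and> m \<le> (n - 1) div 2 \<and> m \<le> i \<and> i \<le> n}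
     \<union> (if n mod 4 = 0 then {w} else {})"

definition separating_set :: "nat \<Rightarrow> 'a::field_char_0 mpol set \<Rightarrow> bool" where
  "separating_set n E \<longleftrightarrow> E \<subseteq> An n \<and>
     (\<forall>v \<in> Vn n. \<forall>v' \<in> Vn n.
        (\<exists>f \<in> An n. eval_at v f \<noteq> eval_at v' f) \<longrightarrow> (\<exists>s \<in> E. eval_at v s \<noteq> eval_at v' s))"

end

theory Submission imports Defs "HOL-Computational_Algebra.Polynomial" begin

text \<open>Let all of \<open>E\<^sub>n\<close> agree on \<open>v\<close> and \<open>v'\<close>. If \<open>f\<^sub>m\<close> is the first of the \<open>f\<^sub>0, f\<^sub>1, \<dots>\<close> that does not vanish at
  \<open>v\<close> and \<open>m \<le> (n - 1) div 2\<close>, then the invariants \<open>\<epsilon>\<close> of the slice \<open>s\<^sub>m\<close> show that \<open>v\<close> and \<open>v'\<close> lie on the same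
  orbit: both can be moved to the same point with \<open>s\<^sub>m = 0\<close>. Otherwise \<open>v\<^sub>i = v'\<^sub>i = 0\<close> for \<open>2 i < n\<close>. Viewing
  points as binary forms, a degeneration along the orbits of a one-parameter family shows that an
  invariant does not change if \<open>v\<close> is replaced by \<open>(-1)\<^sup>q v\<^sub>q e\<^sub>q\<close>, \<open>q = n/2\<close> (by \<open>0\<close> if \<open>n\<close> is odd). Since \<open>f\<^sub>q\<close>
  determines \<open>v\<^sub>q\<close> up to sign, this finishes the proof for \<open>n\<close> odd and for \<open>q\<close> odd; for \<open>q\<close> even, \<open>w\<close> provides the
  missing \<open>v\<^sub>q\<^sup>3\<close>.

  The invariant \<open>w\<close> is the umbral image \<open>y\<^sub>0\<^sup>i y\<^sub>1\<^sup>j y\<^sub>2\<^sup>k \<mapsto> i! j! k! x\<^sub>i x\<^sub>j x\<^sub>k\<close> of the translation invariant polynomial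
  \<open>((y\<^sub>0 - y\<^sub>1) (y\<^sub>1 - y\<^sub>2) (y\<^sub>2 - y\<^sub>0))\<^sup>q\<close>, up to a scalar.\<close>

section \<open>Polynomials, substitution and partial derivatives\<close>

abbreviation lookup where "lookup \<equiv> Poly_Mapping.lookup"
abbreviation keys where "keys \<equiv> Poly_Mapping.keys"
abbreviation single where "single \<equiv> Poly_Mapping.single"

lemma sum_single: "(\<Sum>\<mu>\<in>keys p. single \<mu> (lookup p \<mu>)) = p"
  by (rule poly_mapping_eqI)
     (auto simp: lookup_sum lookup_single when_def in_keys_iff sum.delta' if_distrib cong: if_cong)

text \<open>Serves for polynomials as well as for exponent vectors. The zero mapping is covered by
  \<open>single\<close> with coefficient 0.\<close>

lemma poly_mapping_induct_add [case_names single add]: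
  assumes "\<And>\<mu> c. P (single \<mu> c)" and "\<And>p q. P p \<Longrightarrow> P q \<Longrightarrow> P (p + q)"
  shows "P (p :: 'a \<Rightarrow>\<^sub>0 'b::comm_monoid_add)"
proof -
  have "P 0" using assms(1)[of undefined 0] by simp
  have "P (\<Sum>\<mu>\<in>A. single \<mu> (lookup p \<mu>))" for A
    by (induction A rule: infinite_finite_induct) (auto simp: assms \<open>P 0\<close>)
  from this[of "keys p"] show ?thesis by (simp add: sum_single)
qed

definition power_product :: "(nat \<Rightarrow> 'b::comm_semiring_1) \<Rightarrow> (nat \<Rightarrow>\<^sub>0 nat) \<Rightarrow> 'b" where
  "power_product \<sigma> \<mu> = (\<Prod>i\<in>keys \<mu>. \<sigma> i ^ lookup \<mu> i)"

lemma power_product_superset: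
  assumes "finite S" "keys \<mu> \<subseteq> S"
  shows "power_product \<sigma> \<mu> = (\<Prod>i\<in>S. \<sigma> i ^ lookup \<mu> i)"
  unfolding power_product_def using assms
  by (intro prod.mono_neutral_left) (auto simp: in_keys_iff)

lemma power_product_add: "power_product \<sigma> (\<mu> + \<nu>) = power_product \<sigma> \<mu> * power_product \<sigma> \<nu>"
proof -
  have "keys (\<mu> + \<nu>) \<subseteq> keys \<mu> \<union> keys \<nu>" by (rule keys_add)
  then show ?thesis
    by (simp add: power_product_superset[of "keys \<mu> \<union> keys \<nu>"] lookup_add power_add prod.distrib)
qed

lemma power_product_0 [simp]: "power_product \<sigma> 0 = 1"
  by (simp add: power_product_def)

lemma power_product_single: "power_product \<sigma> (single i k) = \<sigma> i ^ k"
  by (simp add: power_product_def)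

text \<open>Three instances matter: the identity gives evaluation at a point, \<open>Const\<close>
  gives substitution of polynomials for the variables, and \<open>[:c:]\<close> gives restriction to
  a polynomial curve.\<close>

locale coefficient_hom =
  fixes h :: "'a::comm_semiring_1 \<Rightarrow> 'b::comm_semiring_1"
  assumes h_0: "h 0 = 0" and h_1: "h 1 = 1"
    and h_add: "h (a + b) = h a + h b" and h_mult: "h (a * b) = h a * h b"
begin

lemma subst_superset:
  assumes "finite S" "keys p \<subseteq> S"
  shows "subst_hom h \<sigma> p = (\<Sum>\<mu>\<in>S. h (lookup p \<mu>) * power_product \<sigma> \<mu>)"
  unfolding subst_hom_def power_product_def[symmetric] using assms
  by (intro sum.mono_neutral_left) (auto simp: in_keys_iff h_0)

lemma subst_single: "subst_hom h \<sigma> (single \<mu> c) = h c * power_product \<sigma> \<mu>"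
  by (simp add: subst_superset[of "{\<mu>}"])

lemma subst_0: "subst_hom h \<sigma> 0 = 0"
  by (simp add: subst_hom_def)

lemma subst_add: "subst_hom h \<sigma> (p + q) = subst_hom h \<sigma> p + subst_hom h \<sigma> q"
proof -
  have "keys (p + q) \<subseteq> keys p \<union> keys q" by (rule keys_add)
  then show ?thesis
    by (simp add: subst_superset[of "keys p \<union> keys q"] lookup_add h_add sum.distrib algebra_simps)
qed

lemma subst_mult: "subst_hom h \<sigma> (p * q) = subst_hom h \<sigma> p * subst_hom h \<sigma> q"
proof (induction p rule: poly_mapping_induct_add)
  case (single \<mu> c)
  show ?case
  proof (induction q rule: poly_mapping_induct_add)
    case (single \<nu> d)
    show ?case by (simp add: mult_single subst_single h_mult power_product_add mult_ac)
  qed (simp only: distrib_left subst_add)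
qed (simp only: distrib_right subst_add)

lemma subst_1: "subst_hom h \<sigma> 1 = 1"
  using subst_single[of \<sigma> 0 1] by (simp add: h_1)

lemma subst_Const: "subst_hom h \<sigma> (Const c) = h c"
  by (simp add: Const_def subst_single)

lemma subst_Var: "subst_hom h \<sigma> (Var i) = \<sigma> i"
  by (simp add: Var_def subst_single power_product_single h_1)

lemma subst_power: "subst_hom h \<sigma> (p ^ k) = subst_hom h \<sigma> p ^ k"
  by (induction k) (simp_all add: subst_1 subst_mult)

lemma subst_sum: "subst_hom h \<sigma> (\<Sum>i\<in>A. p i) = (\<Sum>i\<in>A. subst_hom h \<sigma> (p i))"
  by (induction A rule: infinite_finite_induct) (simp_all add: subst_0 subst_add)

lemmas subst_simps = subst_0 subst_1 subst_add subst_mult subst_Const subst_Var subst_power subst_sum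

end

lemma Const_0 [simp]: "Const 0 = 0" and Const_1: "Const 1 = 1"
  and Const_add: "Const (a + b) = Const a + Const b"
  by (simp_all add: Const_def single_add)

lemma Const_mult: "Const (a * b) = Const a * Const (b :: 'a::semiring_0)"
  by (simp add: Const_def mult_single)

lemma Const_uminus: "Const (- a) = - Const (a :: 'a::ab_group_add)"
  by (simp add: Const_def single_uminus)

lemma Const_sign: "Const ((- 1) ^ k) = (- 1 :: 'a::comm_ring_1 mpol) ^ k"
  by (induction k) (simp_all add: Const_1 Const_mult Const_uminus)

lemma Const_of_nat: "Const (of_nat k :: 'a::comm_semiring_1) = of_nat k"
  by (induction k) (simp_all add: Const_add Const_1)

lemma coefficient_hom_id: "coefficient_hom (\<lambda>c::'a::comm_semiring_1. c)"
  by unfold_locales simp_all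

lemma coefficient_hom_Const: "coefficient_hom (Const :: 'a::comm_semiring_1 \<Rightarrow> 'a mpol)"
  by unfold_locales (simp_all add: Const_1 Const_add Const_mult)

lemma coefficient_hom_poly: "coefficient_hom (\<lambda>c::'a::comm_semiring_1. [:c:])"
  by unfold_locales (simp_all add: one_pCons mult.commute)

lemmas eval_at_simps =
  coefficient_hom.subst_simps[OF coefficient_hom_id, folded eval_at_def]

lemma eval_at_uminus: "eval_at v (- p) = - eval_at v (p :: 'a::comm_ring_1 mpol)"
  using eval_at_simps(3)[of v p "- p"] by (simp add: eval_at_simps add_eq_0_iff)

section \<open>The subring \<open>Rn n\<close>\<close>

lemma Rn_0 [simp]: "0 \<in> Rn n"
  by (simp add: Rn_def)

lemma Rn_add: "p \<in> Rn n \<Longrightarrow> q \<in> Rn n \<Longrightarrow> p + q \<in> Rn n"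
  unfolding Rn_def using keys_add[of p q] by blast

lemma Rn_mult: "p \<in> Rn n \<Longrightarrow> q \<in> Rn n \<Longrightarrow> p * q \<in> Rn n"
  unfolding Rn_def
proof (intro CollectI ballI)
  fix \<mu> assume *: "p \<in> {p. \<forall>\<mu>\<in>keys p. keys \<mu> \<subseteq> {..n}}" "q \<in> {p. \<forall>\<mu>\<in>keys p. keys \<mu> \<subseteq> {..n}}"
    and "\<mu> \<in> keys (p * q)"
  then obtain \<alpha> \<beta> where "\<mu> = \<alpha> + \<beta>" "\<alpha> \<in> keys p" "\<beta> \<in> keys q"
    using keys_mult[of p q] by blast
  then show "keys \<mu> \<subseteq> {..n}"
    using * keys_add[of \<alpha> \<beta>] by blast
qed

lemma Rn_Const [simp]: "Const c \<in> Rn n"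
  by (auto simp: Rn_def Const_def)

lemma Rn_1 [simp]: "(1 :: 'a::comm_semiring_1 mpol) \<in> Rn n"
  using Rn_Const[of "1 :: 'a" n] by (simp add: Const_1)

lemma Rn_Var: "i \<le> n \<Longrightarrow> (Var i :: 'a::comm_semiring_1 mpol) \<in> Rn n"
  by (auto simp: Rn_def Var_def)

lemma Rn_uminus: "p \<in> Rn n \<Longrightarrow> - p \<in> Rn n" for p :: "'a::comm_ring_1 mpol"
  by (simp add: Rn_def keys_def)

lemma Rn_power: "(p :: 'a::comm_semiring_1 mpol) \<in> Rn n \<Longrightarrow> p ^ k \<in> Rn n"
  by (induction k) (simp_all add: Rn_mult)

lemma Rn_sum: "(\<And>i. i \<in> A \<Longrightarrow> p i \<in> Rn n) \<Longrightarrow> (\<Sum>i\<in>A. p i) \<in> Rn n"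
  by (induction A rule: infinite_finite_induct) (simp_all add: Rn_add)

lemmas Rn_intros = Rn_0 Rn_1 Rn_add Rn_mult Rn_Const Rn_Var Rn_uminus Rn_power Rn_sum

lemma single_eq_Const_mult: "single \<mu> c = Const c * power_product Var (\<mu> :: nat \<Rightarrow>\<^sub>0 nat)"
  for c :: "'a::comm_semiring_1"
proof -
  have *: "single (single i k) (1::'a) = Var i ^ k" for i k
  proof (induction k)
    case (Suc k)
    have "single (single i (Suc k)) (1::'a) = single (single i 1 + single i k) (1 * 1)"
      by (simp flip: single_add)
    then show ?case by (simp only: Suc Var_def flip: mult_single) simp
  qed simp
  have "single \<mu> (1::'a) = power_product Var \<mu>"
  proof (induction \<mu> rule: poly_mapping_induct_add)
    case (add \<mu> \<nu>)
    have "single (\<mu> + \<nu>) (1::'a) = single \<mu> 1 * single \<nu> 1"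
      by (simp add: mult_single)
    then show ?case by (simp add: add power_product_add)
  qed (simp add: * power_product_single)
  then show ?thesis
    by (metis Const_def add_0 mult.right_neutral mult_single)
qed

text \<open>The constants and the variables up to \<open>n\<close> generate \<open>Rn n\<close> as a
  ring. Carrying membership along in \<open>Q\<close> makes it available in the cases
  \<open>add\<close> and \<open>mult\<close>.\<close>

lemma Rn_induct [consumes 1, case_names Const Var add mult]:
  assumes "p \<in> Rn n"
    and Const: "\<And>c. P (Const c)" and Var: "\<And>i. i \<le> n \<Longrightarrow> P (Var i)"
    and add: "\<And>p q. p \<in> Rn n \<Longrightarrow> q \<in> Rn n \<Longrightarrow> P p \<Longrightarrow> P q \<Longrightarrow> P (p + q)"
    and mult: "\<And>p q. p \<in> Rn n \<Longrightarrow> q \<in> Rn n \<Longrightarrow> P p \<Longrightarrow> P q \<Longrightarrow> P (p * q)"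
  shows "P (p :: 'a::comm_semiring_1 mpol)"
proof -
  define Q where "Q p \<longleftrightarrow> p \<in> Rn n \<and> P p" for p
  have Q_Const: "Q (Const c)" for c using Const by (simp add: Q_def)
  have Q_1: "Q 1" using Q_Const[of 1] by (simp add: Const_1)
  have Q_0: "Q 0" using Q_Const[of 0] by simp
  have Q_add: "Q p \<Longrightarrow> Q q \<Longrightarrow> Q (p + q)" for p q
    using add by (simp add: Q_def Rn_add)
  have Q_mult: "Q p \<Longrightarrow> Q q \<Longrightarrow> Q (p * q)" for p q
    using mult by (simp add: Q_def Rn_mult)
  have Q_power: "Q p \<Longrightarrow> Q (p ^ k)" for p k
    by (induction k) (simp_all add: Q_1 Q_mult)
  have Q_prod: "(\<And>i. i \<in> A \<Longrightarrow> Q (f i)) \<Longrightarrow> Q (\<Prod>i\<in>A. f i)" for A and f :: "nat \<Rightarrow> _"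
    by (induction A rule: infinite_finite_induct) (simp_all add: Q_1 Q_mult)
  have "Q (single \<mu> c)" if "keys \<mu> \<subseteq> {..n}" for \<mu> c
    unfolding single_eq_Const_mult power_product_def using that Var
    by (intro Q_mult Q_Const Q_prod Q_power) (auto simp: Q_def Rn_Var)
  moreover have "(\<And>i. i \<in> A \<Longrightarrow> Q (f i)) \<Longrightarrow> Q (\<Sum>i\<in>A. f i)" for A and f :: "(nat \<Rightarrow>\<^sub>0 nat) \<Rightarrow> _"
    by (induction A rule: infinite_finite_induct) (simp_all add: Q_0 Q_add)
  ultimately have "Q (\<Sum>\<mu>\<in>keys p. single \<mu> (lookup p \<mu>))"
    using assms(1) by (auto simp: Rn_def)
  then show ?thesis by (simp add: sum_single Q_def)
qed

lemma eval_at_cong: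
  assumes "f \<in> Rn n" "\<And>i. i \<le> n \<Longrightarrow> v i = v' i"
  shows "eval_at v f = eval_at v' (f :: 'a::comm_semiring_1 mpol)"
  using assms(1) by (induction rule: Rn_induct) (simp_all add: eval_at_simps assms(2))

section \<open>Partial derivatives and the Leibniz rule\<close>

lemma lookup_pdiff:
  "lookup (pdiff i p) \<mu> = of_nat (Suc (lookup \<mu> i)) * lookup p (\<mu> + single i 1)"
proof -
  have "lookup (pdiff i p) \<mu> = (\<Sum>\<nu>\<in>keys p. if \<nu> = \<mu> + single i 1
      then of_nat (Suc (lookup \<mu> i)) * lookup p (\<mu> + single i 1) else 0)"
    unfolding pdiff_def lookup_sum
  proof (rule sum.cong[OF refl])
    fix \<nu>
    \<comment> \<open>Truncated subtraction can be undone only where \<open>x_i\<close> occurs;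
      elsewhere the coefficient is 0.\<close>
    have "\<nu> = \<mu> + single i 1" if "lookup \<nu> i \<noteq> 0" "\<nu> - single i 1 = \<mu>"
      using that by (auto intro!: poly_mapping_eqI simp: lookup_add lookup_minus lookup_single when_def)
    then show "lookup (single (\<nu> - single i 1) (of_nat (lookup \<nu> i) * lookup p \<nu>)) \<mu> =
        (if \<nu> = \<mu> + single i 1 then of_nat (Suc (lookup \<mu> i)) * lookup p (\<mu> + single i 1) else 0)"
      by (cases "\<nu> = \<mu> + single i 1"; cases "lookup \<nu> i = 0")
         (auto simp: lookup_single when_def lookup_add simp del: of_nat_Suc)
  qed
  then show ?thesis
    by (auto simp: in_keys_iff)
qed

lemma pdiff_add: "pdiff i (p + q) = pdiff i p + pdiff i q"
  by (rule poly_mapping_eqI) (simp only: lookup_pdiff lookup_add distrib_left)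

lemma pdiff_single: "pdiff i (single \<mu> c) = single (\<mu> - single i 1) (of_nat (lookup \<mu> i) * c)"
  by (simp add: pdiff_def)

lemma pdiff_0 [simp]: "pdiff i 0 = 0"
  by (simp add: pdiff_def)

lemma pdiff_Const [simp]: "pdiff i (Const c) = 0"
  by (simp add: Const_def pdiff_single)

lemma pdiff_Var: "pdiff i (Var j) = (if i = j then 1 else 0)"
  by (simp add: Var_def pdiff_single lookup_single when_def)

lemma pdiff_mult: "pdiff i (p * q) = pdiff i p * q + p * pdiff i (q :: 'a::comm_semiring_1 mpol)"
proof (induction p rule: poly_mapping_induct_add)
  case (single \<mu> c)
  show ?case
  proof (induction q rule: poly_mapping_induct_add)
    case (single \<nu> d)
    \<comment> \<open>Truncation spoils these identities when \<open>x_i\<close> does not occur, but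
      then the term has the factor \<open>of_nat 0\<close>.\<close>
    have shift: "(\<alpha> - single i 1) + \<beta> = \<alpha> + \<beta> - single i 1"
      "\<beta> + (\<alpha> - single i 1) = \<beta> + \<alpha> - single i 1" if "lookup \<alpha> i \<noteq> 0"
      for \<alpha> \<beta> :: "nat \<Rightarrow>\<^sub>0 nat"
      using that by (auto intro!: poly_mapping_eqI simp: lookup_add lookup_minus lookup_single when_def)
    have "single (\<mu> - single i 1 + \<nu>) (of_nat (lookup \<mu> i) * c * d)
        = single (\<mu> + \<nu> - single i 1) (of_nat (lookup \<mu> i) * c * d)"
      by (cases "lookup \<mu> i = 0") (simp_all add: shift del: One_nat_def)
    moreover have "single (\<mu> + (\<nu> - single i 1)) (c * (of_nat (lookup \<nu> i) * d))
        = single (\<mu> + \<nu> - single i 1) (c * (of_nat (lookup \<nu> i) * d))"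
      by (cases "lookup \<nu> i = 0") (simp_all add: shift del: One_nat_def)
    moreover have "of_nat (lookup (\<mu> + \<nu>) i) * (c * d)
        = of_nat (lookup \<mu> i) * c * d + c * (of_nat (lookup \<nu> i) * d)"
      by (simp add: lookup_add algebra_simps)
    ultimately show ?case
      by (simp only: pdiff_single mult_single single_add)
  qed (simp add: pdiff_add distrib_left add_ac)
qed (simp add: pdiff_add distrib_right add_ac)

section \<open>The derivation and membership in the ring of invariants\<close>

lemma weitz_0 [simp]: "weitz n 0 = 0"
  by (simp add: weitz_def)

lemma weitz_add: "weitz n (p + q) = weitz n p + weitz n q"
  by (simp add: weitz_def pdiff_add distrib_left sum.distrib)

lemma weitz_mult: "weitz n (p * q) = weitz n p * q + p * weitz n q"
  by (simp add: weitz_def pdiff_mult sum_distrib_left sum_distrib_right algebra_simps sum.distrib)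

lemma weitz_Const [simp]: "weitz n (Const c) = 0"
  by (simp add: weitz_def)

lemma weitz_1 [simp]: "weitz n 1 = 0"
  using weitz_Const[of n 1] by (simp add: Const_1)

lemma weitz_Const_mult: "weitz n (Const c * p) = Const c * weitz n p"
  by (simp add: weitz_mult)

lemma weitz_sign_mult: "weitz n ((- 1) ^ k * p) = (- 1) ^ k * weitz n p"
  using weitz_Const_mult[of n "(- 1) ^ k" p] by (simp add: Const_sign)

lemma weitz_sum: "weitz n (\<Sum>i\<in>A. p i) = (\<Sum>i\<in>A. weitz n (p i))"
  by (induction A rule: infinite_finite_induct) (simp_all add: weitz_add)

lemma weitz_power: "weitz n (p ^ k) = of_nat k * p ^ (k - 1) * weitz n p"
proof (induction k)
  case (Suc k)
  then show ?case
    by (cases k) (simp_all add: weitz_mult algebra_simps)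
qed simp

lemma weitz_Var: "weitz n (Var i) = (if 1 \<le> i \<and> i \<le> n then Var (i - 1) else 0)"
proof -
  have "weitz n (Var i) = (\<Sum>j = 1..n. if j = i then Var (j - 1) else 0)"
    unfolding weitz_def by (intro sum.cong) (auto simp: pdiff_Var)
  then show ?thesis by (auto simp: sum.delta)
qed

text \<open>Telescoping: the product of \<open>x_k\<close> and \<open>x_(2m-k-1)\<close> arises from
  the k-th summand and, with opposite sign, from the next one. Only the boundary term
  survives.\<close>

lemma weitz_f_inv_partial:
  assumes "2 * m \<le> n" "j < m"
  shows "weitz n (\<Sum>k = 0..j. (- 1) ^ k * Var k * Var (2 * m - k))
       = (- 1 :: 'a::field_char_0 mpol) ^ j * Var j * Var (2 * m - (j + 1))"
  using assms(2)
proof (induction j)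
  case 0
  then show ?case using assms(1) by (simp add: weitz_mult weitz_Var)
next
  case (Suc j)
  have ind: "2 * m - (j + 1) = 2 * m - Suc j" "2 * m - (Suc j + 1) = 2 * m - Suc j - 1"
    by simp_all
  have D: "weitz n (Var (2 * m - Suc j)) = (Var (2 * m - Suc j - 1) :: 'a mpol)"
    "weitz n (Var (Suc j)) = (Var j :: 'a mpol)"
    using Suc.prems assms(1) by (auto simp: weitz_Var)
  have t: "weitz n ((- 1) ^ Suc j * Var (Suc j) * Var (2 * m - Suc j))
      = (- 1) ^ Suc j * (Var j * Var (2 * m - Suc j) + Var (Suc j) * (Var (2 * m - Suc j - 1) :: 'a mpol))"
    by (simp only: mult.assoc weitz_sign_mult weitz_mult[of n "Var _"] D)
  show ?case
    using Suc unfolding sum.atLeast0_atMost_Suc weitz_add ind t by (simp add: algebra_simps)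
qed

lemma half_add_half: "Const (1 / 2 :: 'a::field_char_0) + Const (1 / 2) = 1"
  by (simp flip: Const_add Const_1)

lemma f_inv_in_An:
  assumes "m \<le> n div 2"
  shows "(f_inv m :: 'a::field_char_0 mpol) \<in> An n"
proof (cases "m = 0")
  case True
  then show ?thesis by (auto simp: f_inv_def An_def weitz_Var intro: Rn_intros)
next
  case False
  have sum: "weitz n (\<Sum>k = 0..m - 1. (- 1) ^ k * Var k * Var (2 * m - k))
      = (- 1 :: 'a mpol) ^ (m - 1) * Var (m - 1) * Var m"
    using weitz_f_inv_partial[where 'a = 'a, of m n "m - 1"] assms False by (simp add: less_eq_div_iff_mult_less_eq mult.commute)
  \<comment> \<open>The two halves add up to the boundary term left at \<open>j = m - 1\<close>,
    with the opposite sign.\<close>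
  have square: "weitz n (Const (1 / 2) * (- 1) ^ m * Var m ^ 2)
      = (- 1 :: 'a mpol) ^ m * ((Const (1 / 2) + Const (1 / 2)) * (Var m * Var (m - 1)))"
    using assms False
    by (simp add: weitz_Const_mult weitz_sign_mult mult.assoc power2_eq_square weitz_mult[of n "Var _"]
        weitz_Var algebra_simps)
  have sign: "(- 1) ^ m = - ((- 1) ^ (m - 1) :: 'a mpol)"
    using False by (cases m) simp_all
  have "weitz n (f_inv m :: 'a mpol) = 0"
    unfolding f_inv_def if_not_P[OF False] weitz_add sum square unfolding half_add_half sign
    by simp
  moreover have "f_inv m \<in> Rn n"
    using assms False by (auto simp: f_inv_def intro!: Rn_intros)
  ultimately show ?thesis by (simp add: An_def)
qed

text \<open>The summands \<open>k\<close> and \<open>k + 1\<close> both contribute the product of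
  \<open>x_k\<close> and \<open>x_(2m-k)\<close>. Their signs are opposite and their weights differ
  by 1, which leaves the k-th summand of \<open>f_inv m\<close>. At \<open>j = m\<close> the last
  weight is 1/2, as for the square in \<open>f_inv m\<close>.\<close>

lemma weitz_s_slice_partial:
  assumes "2 * m + 1 \<le> n" "j \<le> m"
  shows "weitz n (\<Sum>k = 0..j. (- 1) ^ k * Const (of_nat (2 * m + 1 - 2 * k) / 2 :: 'a::field_char_0)
            * Var k * Var (2 * m + 1 - k))
       = (\<Sum>k<j. (- 1) ^ k * Var k * Var (2 * m - k))
         + (- 1) ^ j * Const (of_nat (2 * m + 1 - 2 * j) / 2) * Var j * Var (2 * m - j)"
  using assms(2)
proof (induction j)
  case 0
  then show ?case using assms(1) by (simp add: weitz_Const_mult weitz_mult[of n "Var _"] weitz_Var mult.assoc)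
next
  case (Suc j)
  define c where "c = Const (of_nat (2 * m + 1 - 2 * Suc j) / 2 :: 'a)"
  have "(of_nat (2 * m + 1 - 2 * j) / 2 :: 'a) = of_nat (2 * m + 1 - 2 * Suc j) / 2 + 1"
    using Suc.prems by (simp add: of_nat_diff field_simps)
  then have c: "Const (of_nat (2 * m + 1 - 2 * j) / 2 :: 'a) = c + 1"
    by (simp only: Const_add Const_1 c_def)
  have ind: "2 * m + 1 - Suc j = 2 * m - j"
    by simp
  have D: "weitz n (Var (2 * m + 1 - Suc j)) = (Var (2 * m - Suc j) :: 'a mpol)"
    "weitz n (Var (Suc j)) = (Var j :: 'a mpol)"
    using Suc.prems assms(1) by (auto simp: weitz_Var)
  have "weitz n ((- 1) ^ Suc j * c * Var (Suc j) * Var (2 * m + 1 - Suc j))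
      = (- 1) ^ Suc j * c * (Var j * Var (2 * m - j) + Var (Suc j) * Var (2 * m - Suc j))"
    unfolding c_def
    by (simp only: mult.assoc weitz_sign_mult weitz_Const_mult weitz_mult[of n "Var _"] D)
       (simp only: ind)
  with Suc.IH Suc.prems show ?case
    unfolding sum.atLeast0_atMost_Suc sum.lessThan_Suc weitz_add c c_def[symmetric]
    by (simp add: algebra_simps)
qed

lemma weitz_s_slice:
  assumes "n \<ge> 1" "m \<le> (n - 1) div 2"
  shows "weitz n (s_slice m) = (f_inv m :: 'a::field_char_0 mpol)"
proof (cases "m = 0")
  case True
  then show ?thesis using assms by (simp add: s_slice_def f_inv_def weitz_Var)
next
  case False
  moreover have "{..<m} = {0..m - 1}" using False by auto
  ultimately show ?thesis
    using weitz_s_slice_partial[where 'a = 'a, of m n m] assms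
    by (simp add: s_slice_def f_inv_def power2_eq_square mult_ac)
qed

lemma s_slice_in_Rn:
  assumes "n \<ge> 1" "m \<le> (n - 1) div 2"
  shows "s_slice m \<in> Rn n"
  using assms by (auto simp: s_slice_def intro!: Rn_intros)

lemma weitz_funpow_Var: "i \<le> n \<Longrightarrow> (weitz n ^^ k) (Var i) = (if k \<le> i then Var (i - k) else 0)"
  by (induction k) (auto simp: weitz_Var)

lemma Var_neq_0: "(Var i :: 'a::zero_neq_one mpol) \<noteq> 0"
  by (metis Var_def lookup_single_eq lookup_zero zero_neq_one)

lemma nu_Var: "i \<le> n \<Longrightarrow> nu n (Var i :: 'a::field_char_0 mpol) = i"
  unfolding nu_def by (rule Least_equality) (simp_all add: weitz_funpow_Var Var_neq_0 split: if_splits del: funpow.simps)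

lemma eps_Var:
  "i \<le> n \<Longrightarrow> eps n s (Var i) = (\<Sum>k = 0..i. Const ((- 1) ^ k / fact k) * Var (i - k)
      * s ^ k * weitz n s ^ (i - k))"
  by (simp add: eps_def nu_Var weitz_funpow_Var)

text \<open>Since \<open>weitz n s\<close> is itself killed, differentiating \<open>s ^ k\<close>
  cancels what the previous partial sum leaves. For \<open>a = Var i\<close> and
  \<open>j = d = i\<close> the remainder contains the derivative of order \<open>i + 1\<close> of
  \<open>x_i\<close>, which is 0.\<close>

lemma weitz_eps_partial:
  assumes "weitz n (weitz n s) = 0" "j \<le> d"
  shows "weitz n (\<Sum>k = 0..j. Const ((- 1) ^ k / fact k) * (weitz n ^^ k) a * s ^ k * weitz n s ^ (d - k))
       = Const ((- 1) ^ j / fact j :: 'a::field_char_0) * (weitz n ^^ Suc j) a * s ^ j * weitz n s ^ (d - j)"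
  using assms(2)
proof (induction j)
  case 0
  then show ?case by (simp add: Const_1 weitz_mult weitz_power assms(1))
next
  case (Suc j)
  define c where "c = Const ((- 1) ^ Suc j / fact (Suc j) :: 'a)"
  have "((- 1) ^ j / fact j :: 'a) = - (((- 1) ^ Suc j / fact (Suc j)) * of_nat (Suc j))"
    by (simp add: field_simps del: of_nat_Suc)
  then have c: "Const ((- 1) ^ j / fact j :: 'a) = - (c * of_nat (Suc j))"
    by (simp only: Const_uminus Const_mult Const_of_nat c_def)
  have d: "d - j = Suc (d - Suc j)" using Suc.prems by simp
  have "weitz n (c * (weitz n ^^ Suc j) a * s ^ Suc j * weitz n s ^ (d - Suc j))
      = c * (weitz n ^^ Suc (Suc j)) a * s ^ Suc j * weitz n s ^ (d - Suc j)
        + c * of_nat (Suc j) * (weitz n ^^ Suc j) a * s ^ j * weitz n s ^ (d - j)"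
  proof -
    have s: "weitz n (s ^ Suc j) = of_nat (Suc j) * s ^ j * weitz n s"
      by (simp only: weitz_power diff_Suc_1)
    have "weitz n (weitz n s ^ (d - Suc j)) = 0"
      by (simp add: weitz_power assms(1))
    then show ?thesis
      unfolding c_def d by (simp add: weitz_mult s algebra_simps del: power_Suc of_nat_Suc fact_Suc) simp
  qed
  then show ?case
    using Suc unfolding sum.atLeast0_atMost_Suc weitz_add c c_def[symmetric] by simp
qed

lemma eps_in_An:
  assumes "n \<ge> 1" "m \<le> (n - 1) div 2" "i \<le> n"
  shows "eps n (s_slice m) (Var i :: 'a::field_char_0 mpol) \<in> An n"
proof -
  have f: "weitz n (s_slice m) = (f_inv m :: 'a mpol)" "(f_inv m :: 'a mpol) \<in> An n"
    using assms by (simp_all add: weitz_s_slice f_inv_in_An div_le_mono le_trans)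
  then have "weitz n (eps n (s_slice m) (Var i :: 'a mpol)) = 0"
    unfolding eps_def
    using weitz_eps_partial[where 'a = 'a, of n "s_slice m" "nu n (Var i)" "nu n (Var i)" "Var i"] assms
    by (simp add: An_def nu_Var weitz_funpow_Var del: funpow.simps)
  moreover have "eps n (s_slice m) (Var i :: 'a mpol) \<in> Rn n"
    using assms f s_slice_in_Rn[of n m] by (auto simp: eps_Var An_def intro!: Rn_intros)
  ultimately show ?thesis by (simp add: An_def)
qed

section \<open>Points as polynomials\<close>

text \<open>The point \<open>v\<close> of \<open>\<bbbk>\<^sup>n\<^sup>+\<^sup>1\<close> corresponds to the binary form
  \<open>\<Sum>\<^sub>i v\<^sub>i X\<^sup>n\<^sup>-\<^sup>i Y\<^sup>i / (n - i)!\<close>, dehomogenised at \<open>Y = 1\<close>. The basic action then is the translation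
  \<open>X \<mapsto> X + a\<close>, and \<open>form_point n F a\<close> is the point belonging to the translate of \<open>F\<close>, by Taylor's formula.\<close>

definition form_of :: "nat \<Rightarrow> (nat \<Rightarrow> 'a::field_char_0) \<Rightarrow> 'a poly" where
  "form_of n v = (\<Sum>i\<le>n. smult (v i / fact (n - i)) ([:0, 1:] ^ (n - i)))"

definition form_point :: "nat \<Rightarrow> 'a::field_char_0 poly \<Rightarrow> 'a \<Rightarrow> nat \<Rightarrow> 'a" where
  "form_point n F a i = poly ((pderiv ^^ (n - i)) F) a"

lemma poly_higher_pderiv_0: "poly ((pderiv ^^ m) F) 0 = fact m * coeff F m"
  for F :: "'a::field_char_0 poly"
  by (simp add: poly_0_coeff_0 coeff_higher_pderiv pochhammer_fact)

lemma form_point_0: "form_point n F 0 i = fact (n - i) * coeff F (n - i)"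
  by (simp add: form_point_def poly_higher_pderiv_0)

lemma coeff_X_power: "coeff ([:0, 1:] ^ k :: 'a::comm_semiring_1 poly) j = (if j = k then 1 else 0)"
  using coeff_monom[of "1::'a" k j] by (simp add: monom_altdef)

lemma degree_sum_smult_le:
  assumes "finite A" "\<And>i. i \<in> A \<Longrightarrow> degree (f i) \<le> n"
  shows "degree (\<Sum>i\<in>A. smult (c i) (f i)) \<le> n"
  using assms by (intro degree_sum_le) (auto intro: degree_smult_le order_trans)

lemma degree_form_of: "degree (form_of n v) \<le> n"
  unfolding form_of_def
  by (intro degree_sum_smult_le) (simp_all add: degree_power_eq)

lemma form_point_form_of: "i \<le> n \<Longrightarrow> form_point n (form_of n v) 0 i = v i"
proof -
  assume i: "i \<le> n"
  have "coeff (form_of n v) (n - i) = (\<Sum>j\<le>n. if j = i then v i / fact (n - i) else 0)"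
    unfolding form_of_def coeff_sum using i
    by (intro sum.cong) (auto simp: coeff_X_power)
  then show ?thesis using i by (simp add: form_point_0)
qed

text \<open>This is the chain rule along the curve \<open>\<tau>\<close>; products are covered
  because both sides obey the Leibniz rule.\<close>

lemma pderiv_subst_hom:
  fixes f :: "'a::field_char_0 mpol"
  assumes "f \<in> Rn n"
  shows "pderiv (subst_hom (\<lambda>c. [:c:]) \<tau> f) = (\<Sum>i\<le>n. pderiv (\<tau> i) * subst_hom (\<lambda>c. [:c:]) \<tau> (pdiff i f))"
  using assms
proof (induction rule: Rn_induct)
  case (Var i)
  then have "(\<Sum>j\<le>n. pderiv (\<tau> j) * subst_hom (\<lambda>c. [:c:]) \<tau> (pdiff j (Var i :: 'a mpol)))
      = (\<Sum>j\<le>n. if j = i then pderiv (\<tau> j) else 0)"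
    by (intro sum.cong) (auto simp: pdiff_Var coefficient_hom.subst_simps[OF coefficient_hom_poly])
  with Var show ?case
    by (simp add: coefficient_hom.subst_simps[OF coefficient_hom_poly])
qed (simp_all add: coefficient_hom.subst_simps[OF coefficient_hom_poly] pdiff_add pdiff_mult
       pderiv_add pderiv_mult pderiv_pCons sum.distrib sum_distrib_left algebra_simps)

lemma poly_subst_hom:
  "poly (subst_hom (\<lambda>c. [:c:]) \<tau> f) a = eval_at (\<lambda>i. poly (\<tau> i) a) (f :: 'a::field_char_0 mpol)"
proof -
  note [simp] = coefficient_hom.subst_add[OF coefficient_hom_poly]
    coefficient_hom.subst_single[OF coefficient_hom_poly]
    eval_at_simps(3) coefficient_hom.subst_single[OF coefficient_hom_id, folded eval_at_def]
  show ?thesis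
    by (induction f rule: poly_mapping_induct_add) (simp_all add: power_product_def poly_prod)
qed

text \<open>Along an orbit, the derivative of a polynomial function \<open>f\<close> is \<open>weitz n f\<close>, because
  differentiating the \<open>i\<close>-th coordinate of \<open>form_point n F\<close> gives the \<open>(i - 1)\<close>-st.\<close>

lemma eval_at_form_point:
  fixes f :: "'a::field_char_0 mpol"
  assumes "f \<in> An n" "degree F \<le> n"
  shows "eval_at (form_point n F a) f = eval_at (form_point n F 0) f"
proof -
  define \<tau> where "\<tau> i = (pderiv ^^ (n - i)) F" for i
  let ?S = "subst_hom (\<lambda>c. [:c:]) \<tau>"
  note S = coefficient_hom.subst_simps[OF coefficient_hom_poly]
  have f: "f \<in> Rn n" "weitz n f = 0" using assms(1) by (auto simp: An_def)
  \<comment> \<open>The coordinate \<open>x_0\<close> is the n-th derivative of \<open>F\<close>,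
    hence constant by the degree bound; this matches \<open>D x_0 = 0\<close>.\<close>
  have \<tau>0: "pderiv (\<tau> 0) = 0"
    using assms(2) by (simp add: \<tau>_def pderiv_eq_0_iff degree_higher_pderiv)
  have \<tau>_Suc: "pderiv (\<tau> i) = \<tau> (i - 1)" if "i \<in> {1..n}" for i
  proof -
    have "n - (i - 1) = Suc (n - i)" using that by auto
    then show ?thesis unfolding \<tau>_def by simp
  qed
  have "pderiv (?S f) = (\<Sum>i\<le>n. pderiv (\<tau> i) * ?S (pdiff i f))"
    by (rule pderiv_subst_hom[OF f(1)])
  also have "\<dots> = (\<Sum>i\<in>{1..n}. pderiv (\<tau> i) * ?S (pdiff i f))"
  proof (rule sum.mono_neutral_right)
    have "{..n} - {1..n} = {0}" by auto
    then show "\<forall>i\<in>{..n} - {1..n}. pderiv (\<tau> i) * ?S (pdiff i f) = 0" by (simp add: \<tau>0)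
  qed auto
  also have "\<dots> = ?S (weitz n f)"
    unfolding weitz_def S by (intro sum.cong) (simp_all add: \<tau>_Suc)
  finally have "pderiv (?S f) = 0" by (simp add: f(2) S)
  then obtain h where "?S f = [:h:]" using pderiv_iszero by blast
  moreover have "eval_at (form_point n F b) f = poly (?S f) b" for b
    by (simp add: poly_subst_hom form_point_def[abs_def] \<tau>_def)
  ultimately show ?thesis by simp
qed

text \<open>Taylor expansion. The right-hand side is the value of \<open>exp(a D) x_i\<close> at
  \<open>v\<close>, in the shape in which it occurs in \<open>eps\<close>.\<close>

lemma form_point_shift:
  fixes v :: "nat \<Rightarrow> 'a::field_char_0"
  assumes "i \<le> n"
  shows "form_point n (form_of n v) a i = (\<Sum>k = 0..i. v (i - k) * a ^ k / fact k)"
proof -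
  let ?F = "form_of n v"
  let ?p = "(pderiv ^^ (n - i)) ?F"
  have "degree ?p \<le> i" using degree_form_of[of n v] by (simp add: degree_higher_pderiv)
  then have "poly ?p a = (\<Sum>k\<le>i. coeff ?p k * a ^ k)"
    unfolding poly_altdef by (intro sum.mono_neutral_left) (auto intro: coeff_eq_0)
  also have "\<dots> = (\<Sum>k\<le>i. v (i - k) * a ^ k / fact k)"
  proof (rule sum.cong[OF refl])
    fix k assume "k \<in> {..i}"
    then have k: "n - (i - k) = k + (n - i)" using assms by auto
    have "coeff ?p k = form_point n ?F 0 (i - k) / fact k"
      unfolding form_point_def k funpow_add comp_apply by (simp add: poly_higher_pderiv_0)
    then show "coeff ?p k * a ^ k = v (i - k) * a ^ k / fact k"
      using assms by (simp add: form_point_form_of)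
  qed
  finally show ?thesis by (simp add: form_point_def atMost_atLeast0)
qed

text \<open>The reason is that \<open>eps n s (Var i)\<close> is \<open>exp(a D) x_i\<close> at
  \<open>a = - s / D s\<close>, cleared of denominators by the i-th power of
  \<open>D s\<close>.\<close>

lemma eval_at_eps:
  fixes v :: "nat \<Rightarrow> 'a::field_char_0"
  assumes "i \<le> n" "eval_at v (weitz n s) \<noteq> 0"
  shows "eval_at v (eps n s (Var i))
    = eval_at v (weitz n s) ^ i * form_point n (form_of n v) (- eval_at v s / eval_at v (weitz n s)) i"
proof -
  define c where "c = eval_at v (weitz n s)"
  define t where "t = eval_at v s"
  have "c \<noteq> 0" using assms by (simp add: c_def)
  then have *: "(- 1) ^ k / fact k * v (i - k) * t ^ k * c ^ (i - k)
      = c ^ i * (v (i - k) * (- t / c) ^ k / fact k)" if "k \<le> i" for k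
    using that by (simp add: power_diff power_minus[of "t / c"] power_divide mult_ac)
  have "eval_at v (eps n s (Var i)) = (\<Sum>k = 0..i. (- 1) ^ k / fact k * v (i - k) * t ^ k * c ^ (i - k))"
    by (simp add: eps_Var[OF assms(1)] eval_at_simps c_def t_def)
  also have "\<dots> = (\<Sum>k = 0..i. c ^ i * (v (i - k) * (- t / c) ^ k / fact k))"
    by (intro sum.cong) (simp_all only: * atLeastAtMost_iff)
  finally show ?thesis
    by (simp only: form_point_shift[OF assms(1)] sum_distrib_left c_def t_def)
qed

text \<open>On the locus \<open>D s \<noteq> 0\<close>, the values of \<open>eps n s\<close> determine the point of the orbit where \<open>s\<close> vanishes.\<close>

lemma slice_separates:
  fixes f :: "'a::field_char_0 mpol"
  assumes "f \<in> An n"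
    and "eval_at v (weitz n s) = c" "eval_at v' (weitz n s) = c" "c \<noteq> 0"
    and "\<And>i. i \<le> n \<Longrightarrow> eval_at v (eps n s (Var i)) = eval_at v' (eps n s (Var i))"
  shows "eval_at v f = eval_at v' f"
proof -
  have f: "f \<in> Rn n" using assms(1) by (simp add: An_def)
  have orbit: "eval_at u f = eval_at (form_point n (form_of n u) b) f" for u b
  proof -
    have "eval_at u f = eval_at (form_point n (form_of n u) 0) f"
      by (rule eval_at_cong[OF f]) (simp add: form_point_form_of)
    then show ?thesis using eval_at_form_point[OF assms(1) degree_form_of] by metis
  qed
  let ?b = "\<lambda>u. - eval_at u s / c"
  have "form_point n (form_of n v) (?b v) i = form_point n (form_of n v') (?b v') i" if "i \<le> n" for i
    using assms(2-4) assms(5)[OF that] by (simp add: eval_at_eps[OF that])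
  then have "eval_at (form_point n (form_of n v) (?b v)) f = eval_at (form_point n (form_of n v') (?b v')) f"
    by (intro eval_at_cong[OF f])
  then show ?thesis using orbit by metis
qed

section \<open>Polynomial dependence on a parameter\<close>

text \<open>Formulated for functions of \<open>b\<close>, so that families of polynomials can be
  treated coefficient by coefficient instead of as bivariate polynomials.\<close>

definition polynomial_function :: "('a::field_char_0 \<Rightarrow> 'a) \<Rightarrow> bool" where
  "polynomial_function g \<longleftrightarrow> (\<exists>p. \<forall>b. g b = poly p b)"

lemma polynomial_function_const: "polynomial_function (\<lambda>b. c)"
  unfolding polynomial_function_def by (rule exI[of _ "[:c:]"]) simp

lemma polynomial_function_id: "polynomial_function (\<lambda>b. b)"
  unfolding polynomial_function_def by (rule exI[of _ "[:0, 1:]"]) simp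

lemma polynomial_function_add:
  "polynomial_function g \<Longrightarrow> polynomial_function h \<Longrightarrow> polynomial_function (\<lambda>b. g b + h b)"
  unfolding polynomial_function_def by (metis poly_add)

lemma polynomial_function_mult:
  "polynomial_function g \<Longrightarrow> polynomial_function h \<Longrightarrow> polynomial_function (\<lambda>b. g b * h b)"
  unfolding polynomial_function_def by (metis poly_mult)

lemma polynomial_function_uminus:
  "polynomial_function g \<Longrightarrow> polynomial_function (\<lambda>b. - g b)"
  unfolding polynomial_function_def by (metis poly_minus)

lemma polynomial_function_power:
  "polynomial_function g \<Longrightarrow> polynomial_function (\<lambda>b. g b ^ k)"
  unfolding polynomial_function_def by (metis poly_power)

lemma polynomial_function_sum:
  "(\<And>i. i \<in> A \<Longrightarrow> polynomial_function (g i)) \<Longrightarrow> polynomial_function (\<lambda>b. \<Sum>i\<in>A. g i b)"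
  by (induction A rule: infinite_finite_induct)
     (simp_all add: polynomial_function_const polynomial_function_add)

lemma polynomial_function_linear_power:
  assumes "polynomial_function c" "polynomial_function d"
  shows "polynomial_function (\<lambda>b. coeff ([:c b, d b:] ^ k) j)"
proof (induction k arbitrary: j)
  case 0
  then show ?case by (simp add: polynomial_function_const)
next
  case (Suc k)
  have "polynomial_function (\<lambda>b. c b * coeff ([:c b, d b:] ^ k) j
      + (case j of 0 \<Rightarrow> 0 | Suc i \<Rightarrow> d b * coeff ([:c b, d b:] ^ k) i))"
    using assms Suc
    by (cases j) (auto intro!: polynomial_function_add polynomial_function_mult polynomial_function_const)
  then show ?case
    by (cases j) (simp_all add: algebra_simps)
qed

lemma polynomial_function_coeff_mult:
  assumes "\<And>j. polynomial_function (\<lambda>b. coeff (F b) j)" "\<And>j. polynomial_function (\<lambda>b. coeff (G b) j)"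
  shows "polynomial_function (\<lambda>b. coeff (F b * G b) j)"
  unfolding coeff_mult by (intro polynomial_function_sum polynomial_function_mult assms)

lemmas polynomial_function_intros =
  polynomial_function_const polynomial_function_id polynomial_function_add polynomial_function_mult
  polynomial_function_uminus polynomial_function_power polynomial_function_sum polynomial_function_linear_power
  polynomial_function_coeff_mult

lemma polynomial_function_eval_at:
  fixes f :: "'a::field_char_0 mpol"
  assumes "\<And>i. polynomial_function (\<lambda>b. g b i)"
  shows "polynomial_function (\<lambda>b. eval_at (g b) f)"
proof -
  obtain \<tau> where "\<And>i b. g b i = poly (\<tau> i) b"
    using assms unfolding polynomial_function_def by metis
  then have "g b = (\<lambda>i. poly (\<tau> i) b)" for b by auto
  then show ?thesis
    unfolding polynomial_function_def by (metis poly_subst_hom)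
qed

text \<open>Stands in for the limit as \<open>b\<close> tends to 0: the difference has infinitely
  many roots, because a field of characteristic zero is infinite.\<close>

lemma polynomial_function_eq_at_0:
  fixes g h :: "'a::field_char_0 \<Rightarrow> 'a"
  assumes "polynomial_function g" "polynomial_function h" "\<And>b. b \<noteq> 0 \<Longrightarrow> g b = h b"
  shows "g 0 = h 0"
proof -
  obtain p q where pq: "\<And>b. g b = poly p b" "\<And>b. h b = poly q b"
    using assms unfolding polynomial_function_def by metis
  have "p - q = 0"
  proof (rule ccontr)
    assume "p - q \<noteq> 0"
    then have "finite {b. poly (p - q) b = 0}" by (rule poly_roots_finite)
    moreover have "- {0} \<subseteq> {b. poly (p - q) b = 0}" using assms(3) pq by auto
    ultimately have "finite (- {0::'a})" by (rule rev_finite_subset)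
    then have "finite (insert 0 (- {0::'a}))" by simp
    moreover have "insert 0 (- {0::'a}) = UNIV" by auto
    ultimately show False using infinite_UNIV_char_0[where 'a = 'a] by simp
  qed
  then show ?thesis by (simp add: pq)
qed

lemma higher_pderiv_pcompose_shift:
  "(pderiv ^^ m) (pcompose F [:a, 1:]) = pcompose ((pderiv ^^ m) F) [:a, 1:]"
  for F :: "'a::field_char_0 poly"
  by (induction m) (simp_all add: pderiv_pcompose pderiv_pCons)

lemma pcompose_power: "pcompose (p ^ k) q = pcompose p q ^ k" for p :: "'a::comm_semiring_1 poly"
  by (induction k) (simp_all add: pcompose_mult pcompose_1)

lemma form_point_pcompose: "form_point n (pcompose F [:a, 1:]) 0 = form_point n F a"
  by (rule ext) (simp add: form_point_def higher_pderiv_pcompose_shift poly_pcompose)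

text \<open>Writing \<open>F = \<Sum>\<^sub>i c\<^sub>i X\<^sup>n\<^sup>-\<^sup>i Y\<^sup>i\<close>, the invariant \<open>f\<close> takes the same value at \<open>F(X, Y + b X)\<close>
  and at its translate \<open>F(X - Y/b, b X) = \<Sum>\<^sub>i (-1)\<^sup>n\<^sup>-\<^sup>i c\<^sub>i b\<^sup>2\<^sup>i\<^sup>-\<^sup>n (Y - b X)\<^sup>n\<^sup>-\<^sup>i X\<^sup>i\<close>. If only terms with
  \<open>2 i \<ge> n\<close> occur, then both are polynomial in \<open>b\<close>, and one may put \<open>b = 0\<close>.\<close>

lemma eval_at_degeneration:
  fixes f :: "'a::field_char_0 mpol"
  assumes f: "f \<in> An n" and v: "\<And>i. 2 * i < n \<Longrightarrow> v i = 0"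
  shows "eval_at v f = eval_at (\<lambda>i. if 2 * i = n then (- 1) ^ i * v i else 0) f"
proof -
  \<comment> \<open>At \<open>Y = 1\<close> the linear form \<open>Y + b X\<close> becomes
    \<open>[:1, b:]\<close>.\<close>
  define F where "F b = (\<Sum>i\<le>n. smult (v i / fact (n - i)) ([:0, 1:] ^ (n - i) * [:1, b:] ^ i))" for b
  \<comment> \<open>For \<open>2 * i < n\<close> the true exponent of \<open>b\<close> is negative;
    truncation is harmless there because \<open>v i = 0\<close>.\<close>
  define G where "G b = (\<Sum>i\<le>n. smult (v i / fact (n - i) * (- 1) ^ (n - i) * b ^ (2 * i - n))
      ([:1, - b:] ^ (n - i) * [:0, 1:] ^ i))" for b
  have deg: "degree (F b) \<le> n" for b
    unfolding F_def
  proof (intro degree_sum_smult_le)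
    fix i assume "i \<in> {..n}"
    have "degree ([:0, 1:] ^ (n - i) * [:1, b:] ^ i) \<le> degree ([:0, 1::'a:] ^ (n - i)) + degree ([:1, b:] ^ i)"
      by (rule degree_mult_le)
    also have "\<dots> \<le> (n - i) + i"
      using degree_power_le[of "[:1, b:]" i] degree_power_le[of "[:0, 1::'a:]" "n - i"]
      by (intro add_mono) (auto split: if_splits)
    finally show "degree ([:0, 1:] ^ (n - i) * [:1, b:] ^ i) \<le> n" using \<open>i \<in> {..n}\<close> by simp
  qed simp
  have shift: "pcompose (F b) [:- 1 / b, 1:] = G b" if "b \<noteq> 0" for b
    unfolding F_def G_def pcompose_sum
  proof (rule sum.cong[OF refl])
    fix i assume i: "i \<in> {..n}"
    show "pcompose (smult (v i / fact (n - i)) ([:0, 1:] ^ (n - i) * [:1, b:] ^ i)) [:- 1 / b, 1:]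
      = smult (v i / fact (n - i) * (- 1) ^ (n - i) * b ^ (2 * i - n)) ([:1, - b:] ^ (n - i) * [:0, 1:] ^ i)"
    proof (cases "2 * i < n")
      case False
      have 1: "[:- 1 / b, 1:] = smult (- 1 / b) [:1, - b:]" and 2: "[:0, b:] = smult b [:0, 1:]"
        using that by simp_all
      have "(- 1 / b) ^ (n - i) * b ^ i = (- 1) ^ (n - i) * b ^ (2 * i - n)"
      proof -
        have "b ^ i = b ^ (n - i) * b ^ (2 * i - n)"
          using False i by (simp flip: power_add)
        then show ?thesis using that by (simp add: power_minus[of "1 / b"] power_divide)
      qed
      moreover have "pcompose (smult (v i / fact (n - i)) ([:0, 1:] ^ (n - i) * [:1, b:] ^ i)) [:- 1 / b, 1:]
          = smult (v i / fact (n - i)) ([:- 1 / b, 1:] ^ (n - i) * [:0, b:] ^ i)"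
        using that by (simp add: pcompose_smult pcompose_mult pcompose_power pcompose_pCons)
      moreover have "\<dots> = smult (v i / fact (n - i) * ((- 1 / b) ^ (n - i) * b ^ i)) ([:1, - b:] ^ (n - i) * [:0, 1:] ^ i)"
        unfolding 1 2 smult_power by (simp only: mult_smult_left mult_smult_right smult_smult mult_ac)
      ultimately show ?thesis by (simp only: mult.assoc)
    qed (simp add: v)
  qed
  have "eval_at (form_point n (F b) 0) f = eval_at (form_point n (G b) 0) f" if "b \<noteq> 0" for b
    using eval_at_form_point[OF f deg, of b "- 1 / b"]
    by (simp add: form_point_pcompose flip: shift[OF that])
  moreover have "polynomial_function (\<lambda>b. coeff (F b) j)" "polynomial_function (\<lambda>b. coeff (G b) j)" for j
    unfolding F_def G_def coeff_sum coeff_smult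
    by (intro polynomial_function_intros)+
  then have "polynomial_function (\<lambda>b. eval_at (form_point n (F b) 0) f)"
    "polynomial_function (\<lambda>b. eval_at (form_point n (G b) 0) f)"
    by (auto intro!: polynomial_function_eval_at polynomial_function_mult polynomial_function_const
        simp: form_point_0)
  ultimately have eq: "eval_at (form_point n (F 0) 0) f = eval_at (form_point n (G 0) 0) f"
    using polynomial_function_eq_at_0 by blast
  have Rn: "f \<in> Rn n" using f by (simp add: An_def)
  have "F 0 = form_of n v" by (simp add: F_def form_of_def one_pCons[symmetric])
  then have "eval_at v f = eval_at (form_point n (F 0) 0) f"
    by (intro eval_at_cong[OF Rn]) (simp add: form_point_form_of)
  also have "\<dots> = eval_at (\<lambda>i. if 2 * i = n then (- 1) ^ i * v i else 0) f"
    unfolding eq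
  proof (rule eval_at_cong[OF Rn])
    fix i assume i: "i \<le> n"
    \<comment> \<open>At \<open>b = 0\<close> only \<open>2 * j = n\<close> survives: below the
      middle \<open>v j\<close> vanishes, above it \<open>0 ^ (2 * j - n)\<close> does. The
      surviving term is a multiple of \<open>X ^ j\<close>, so it sits at place \<open>n - i\<close>
      exactly for \<open>i = j\<close>.\<close>
    have "coeff (G 0) (n - i) = (\<Sum>j\<le>n. if j = i \<and> 2 * i = n then v i / fact (n - i) * (- 1) ^ i else 0)"
      unfolding G_def coeff_sum
    proof (rule sum.cong[OF refl])
      fix j assume j: "j \<in> {..n}"
      have "coeff ([:1, - 0:] ^ (n - j) * [:0, 1:] ^ j :: 'a poly) (n - i) = (if n - i = j then 1 else 0)"
      proof -
        have "[:1, - 0:] = (1 :: 'a poly)" by (simp add: one_pCons)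
        then show ?thesis by (simp only: power_one mult_1_left coeff_X_power)
      qed
      then show "coeff (smult (v j / fact (n - j) * (- 1) ^ (n - j) * 0 ^ (2 * j - n))
          ([:1, - 0:] ^ (n - j) * [:0, 1:] ^ j)) (n - i)
        = (if j = i \<and> 2 * i = n then v i / fact (n - i) * (- 1) ^ i else 0)"
        using i j v[of j] by (cases "2 * j" n rule: linorder_cases) auto
    qed
    also have "\<dots> = (if 2 * i = n then v i / fact (n - i) * (- 1) ^ i else 0)"
      using i by simp
    finally show "form_point n (G 0) 0 i = (if 2 * i = n then (- 1) ^ i * v i else 0)"
      by (simp add: form_point_0)
  qed
  finally show ?thesis .
qed

section \<open>The cubic invariant\<close>

lemma pdiff_diff: "pdiff i (p - q) = pdiff i p - pdiff i (q :: 'a::comm_ring_1 mpol)"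
  using pdiff_add[of i "p - q" q] by (simp add: algebra_simps)

lemma lookup_mult_eq_sum:
  "lookup (p * q) \<mu> = (\<Sum>(\<alpha>, \<beta>)\<in>keys p \<times> keys q. if \<alpha> + \<beta> = \<mu> then lookup p \<alpha> * lookup q \<beta> else 0)"
  for p :: "'b::monoid_add \<Rightarrow>\<^sub>0 'a::semiring_0"
proof -
  have "p * q = (\<Sum>\<alpha>\<in>keys p. single \<alpha> (lookup p \<alpha>)) * (\<Sum>\<beta>\<in>keys q. single \<beta> (lookup q \<beta>))"
    by (simp add: sum_single)
  also have "\<dots> = (\<Sum>(\<alpha>, \<beta>)\<in>keys p \<times> keys q. single (\<alpha> + \<beta>) (lookup p \<alpha> * lookup q \<beta>))"
    by (simp add: sum_product sum.cartesian_product mult_single)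
  finally show ?thesis
    by (simp add: lookup_sum lookup_single when_def case_prod_unfold)
qed

text \<open>In other terms, \<open>x^\<delta> p(1/x) = \<epsilon> p(x)\<close>. Asking for
  \<open>\<mu> + \<nu> = \<delta>\<close> instead of using truncated subtraction also bounds all
  exponents by \<open>\<delta>\<close>, and \<open>\<epsilon> \<noteq> 0\<close> makes the
  complement of a key a key.\<close>

definition reciprocal :: "(nat \<Rightarrow>\<^sub>0 nat) \<Rightarrow> int \<Rightarrow> int mpol \<Rightarrow> bool" where
  "reciprocal \<delta> \<epsilon> p \<longleftrightarrow> \<epsilon> \<noteq> 0 \<and> (\<forall>\<mu>\<in>keys p. \<exists>\<nu>. \<mu> + \<nu> = \<delta> \<and> lookup p \<nu> = \<epsilon> * lookup p \<mu>)"

lemma reciprocal_keys: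
  assumes "reciprocal \<delta> \<epsilon> p" "\<mu> \<in> keys p"
  shows "\<mu> + (\<delta> - \<mu>) = \<delta>" "lookup p (\<delta> - \<mu>) = \<epsilon> * lookup p \<mu>" "\<delta> - \<mu> \<in> keys p"
    "\<delta> - (\<delta> - \<mu>) = \<mu>"
proof -
  obtain \<nu> where \<nu>: "\<mu> + \<nu> = \<delta>" "lookup p \<nu> = \<epsilon> * lookup p \<mu>" "\<epsilon> \<noteq> 0"
    using assms by (auto simp: reciprocal_def)
  then have "\<delta> - \<mu> = \<nu>" by auto
  with \<nu> assms(2) show "\<mu> + (\<delta> - \<mu>) = \<delta>" "lookup p (\<delta> - \<mu>) = \<epsilon> * lookup p \<mu>" "\<delta> - \<mu> \<in> keys p"
    "\<delta> - (\<delta> - \<mu>) = \<mu>"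
    by (auto simp: in_keys_iff)
qed

text \<open>Complementing in both factors is an involution on pairs of monomials; it exchanges the
  pairs contributing to \<open>\<mu>\<close> with those contributing to
  \<open>\<nu>\<close>.\<close>

lemma reciprocal_mult:
  assumes p: "reciprocal \<delta> \<epsilon> p" and q: "reciprocal \<delta>' \<epsilon>' q"
  shows "reciprocal (\<delta> + \<delta>') (\<epsilon> * \<epsilon>') (p * q)"
  unfolding reciprocal_def
proof (intro conjI ballI)
  fix \<mu> assume "\<mu> \<in> keys (p * q)"
  then obtain \<alpha> \<beta> where \<mu>: "\<mu> = \<alpha> + \<beta>" "\<alpha> \<in> keys p" "\<beta> \<in> keys q"
    using keys_mult[of p q] by blast
  define \<nu> where "\<nu> = (\<delta> - \<alpha>) + (\<delta>' - \<beta>)"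
  have complement: "a + b + ((\<delta> - a) + (\<delta>' - b)) = \<delta> + \<delta>'" if "a \<in> keys p" "b \<in> keys q" for a b
    using reciprocal_keys(1)[OF p that(1)] reciprocal_keys(1)[OF q that(2)] by (metis add.assoc add.left_commute)
  have sum: "\<mu> + \<nu> = \<delta> + \<delta>'"
    unfolding \<nu>_def \<mu>(1) using complement \<mu> by simp
  have iff: "(\<delta> - a) + (\<delta>' - b) = \<nu> \<longleftrightarrow> a + b = \<mu>" if "a \<in> keys p" "b \<in> keys q" for a b
    using complement[OF that] sum by (metis add_left_cancel add_right_cancel)
  have "lookup (p * q) \<nu> = (\<Sum>(a, b)\<in>keys p \<times> keys q. if a + b = \<nu> then lookup p a * lookup q b else 0)"
    by (rule lookup_mult_eq_sum)
  also have "\<dots> = (\<Sum>(a, b)\<in>keys p \<times> keys q. if a + b = \<mu> then \<epsilon> * \<epsilon>' * (lookup p a * lookup q b) else 0)"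
    by (rule sum.reindex_bij_witness[symmetric, of _ "\<lambda>(a, b). (\<delta> - a, \<delta>' - b)" "\<lambda>(a, b). (\<delta> - a, \<delta>' - b)"])
       (auto simp: reciprocal_keys[OF p] reciprocal_keys[OF q] iff)
  also have "\<dots> = \<epsilon> * \<epsilon>' * lookup (p * q) \<mu>"
    unfolding lookup_mult_eq_sum sum_distrib_left by (intro sum.cong) auto
  finally show "\<exists>\<nu>. \<mu> + \<nu> = \<delta> + \<delta>' \<and> lookup (p * q) \<nu> = \<epsilon> * \<epsilon>' * lookup (p * q) \<mu>"
    using sum by blast
qed (use p q in \<open>simp add: reciprocal_def\<close>)

lemma reciprocal_1: "reciprocal 0 1 1"
  by (simp add: reciprocal_def)

text \<open>Multiplying \<open>1/x_i - 1/x_j\<close> by \<open>x_i x_j\<close> gives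
  \<open>x_j - x_i\<close>.\<close>

lemma reciprocal_Var_diff:
  assumes "i \<noteq> j"
  shows "reciprocal (single i 1 + single j 1) (- 1) (Var i - Var j)"
proof -
  have neq: "single i (1::nat) \<noteq> single j 1"
    using assms by (metis lookup_single_eq lookup_single_not_eq zero_neq_one)
  then have "keys (Var i - Var j :: int mpol) \<subseteq> {single i 1, single j 1}"
    by (auto simp: in_keys_iff lookup_minus Var_def lookup_single when_def split: if_splits)
  with neq show ?thesis
    unfolding reciprocal_def
    by (fastforce simp: lookup_minus Var_def lookup_single when_def add.commute simp del: One_nat_def)
qed

definition exponent :: "nat \<Rightarrow> nat \<Rightarrow> nat \<Rightarrow> nat \<Rightarrow>\<^sub>0 nat" where
  "exponent i j k = single 0 i + single 1 j + single 2 k"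

lemma exponent_add: "exponent i j k + exponent i' j' k' = exponent (i + i') (j + j') (k + k')"
  by (simp add: exponent_def single_add add_ac)

text \<open>Integer coefficients, because positivity of a sum of squares is used below and the field
  need not be ordered.\<close>

definition vandermonde :: "int mpol" where
  "vandermonde = (Var 0 - Var 1) * (Var 1 - Var 2) * (Var 2 - Var 0)"

lemma reciprocal_vandermonde_power:
  "\<exists>\<epsilon>. reciprocal (exponent (2 * r) (2 * r) (2 * r)) \<epsilon> (vandermonde ^ r)"
proof (induction r)
  case 0
  show ?case using reciprocal_1 by (auto simp: exponent_def)
next
  case (Suc r)
  then obtain \<epsilon> where \<epsilon>: "reciprocal (exponent (2 * r) (2 * r) (2 * r)) \<epsilon> (vandermonde ^ r)" by blast
  have "reciprocal (single 0 1 + single 1 1 + (single 1 1 + single 2 1) + (single 2 1 + single 0 1))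
      (- 1 * - 1 * - 1) vandermonde"
    unfolding vandermonde_def
    by (intro reciprocal_mult reciprocal_Var_diff) simp_all
  moreover have "single 0 1 + single 1 1 + (single 1 1 + single 2 1) + (single 2 1 + single 0 1) = exponent 2 2 2"
    by (rule poly_mapping_eqI) (auto simp: exponent_def lookup_add lookup_single when_def simp del: single_numeral single_one)
  ultimately have "reciprocal (exponent 2 2 2) (- 1 * - 1 * - 1) vandermonde" by simp
  from reciprocal_mult[OF this \<epsilon>] show ?case
    by (auto simp: exponent_add)
qed

lemma vandermonde_neq_0: "vandermonde \<noteq> 0"
proof -
  have "Var i - Var j \<noteq> (0 :: int mpol)" if "i \<noteq> j" for i j
  proof
    assume "Var i - Var j = (0 :: int mpol)"
    then have "lookup (Var i :: int mpol) (single i 1) = lookup (Var j) (single i 1)" by simp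
    moreover have "single j (1::nat) \<noteq> single i 1"
      using that by (metis lookup_single_eq lookup_single_not_eq zero_neq_one)
    ultimately show False by (simp add: Var_def lookup_single when_def)
  qed
  then show ?thesis by (simp add: vandermonde_def)
qed

text \<open>The reciprocity of \<open>g = vandermonde ^ r\<close> turns the central coefficient of \<open>g * g\<close> into a sum of
  squares, up to a nonzero factor.\<close>

lemma central_coefficient_neq_0:
  "lookup (vandermonde ^ (2 * r)) (exponent (2 * r) (2 * r) (2 * r)) \<noteq> 0"
proof -
  define g where "g = vandermonde ^ r"
  define \<delta> where "\<delta> = exponent (2 * r) (2 * r) (2 * r)"
  obtain \<epsilon> where rec: "reciprocal \<delta> \<epsilon> g"
    using reciprocal_vandermonde_power by (auto simp: g_def \<delta>_def)
  have "lookup (g * g) \<delta> = (\<Sum>\<alpha>\<in>keys g. \<Sum>\<beta>\<in>keys g. if \<alpha> + \<beta> = \<delta> then lookup g \<alpha> * lookup g \<beta> else 0)"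
    unfolding lookup_mult_eq_sum by (simp add: sum.cartesian_product)
  also have "\<dots> = (\<Sum>\<alpha>\<in>keys g. \<epsilon> * (lookup g \<alpha>)\<^sup>2)"
  proof (rule sum.cong[OF refl])
    fix \<alpha> assume \<alpha>: "\<alpha> \<in> keys g"
    note r = reciprocal_keys[OF rec \<alpha>]
    have "(\<Sum>\<beta>\<in>keys g. if \<alpha> + \<beta> = \<delta> then lookup g \<alpha> * lookup g \<beta> else 0)
        = (\<Sum>\<beta>\<in>keys g. if \<beta> = \<delta> - \<alpha> then lookup g \<alpha> * lookup g (\<delta> - \<alpha>) else 0)"
      using r(1) by (intro sum.cong) auto
    then show "(\<Sum>\<beta>\<in>keys g. if \<alpha> + \<beta> = \<delta> then lookup g \<alpha> * lookup g \<beta> else 0) = \<epsilon> * (lookup g \<alpha>)\<^sup>2"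
      using r by (simp add: power2_eq_square)
  qed
  also have "\<dots> = \<epsilon> * (\<Sum>\<alpha>\<in>keys g. (lookup g \<alpha>)\<^sup>2)"
    by (simp add: sum_distrib_left)
  finally have *: "lookup (g * g) \<delta> = \<epsilon> * (\<Sum>\<alpha>\<in>keys g. (lookup g \<alpha>)\<^sup>2)" .
  have "g \<noteq> 0" using vandermonde_neq_0 by (simp add: g_def)
  then have "keys g \<noteq> {}" by simp
  then have "(\<Sum>\<alpha>\<in>keys g. (lookup g \<alpha>)\<^sup>2) > 0"
    by (intro sum_pos) (auto simp: in_keys_iff)
  moreover have "\<epsilon> \<noteq> 0" using rec by (simp add: reciprocal_def)
  moreover have "vandermonde ^ (2 * r) = g * g" by (simp add: g_def mult_2 power_add)
  ultimately show ?thesis using * by (simp add: \<delta>_def)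
qed

text \<open>The factorials turn partial derivatives into index shifts. The condition
  \<open>i + j + k = 3 * q\<close> records the homogeneity of \<open>vandermonde ^ q\<close>, which
  the projection in \<open>extra_invariant_exists\<close> relies on.\<close>

definition cubic_coeff :: "nat \<Rightarrow> nat \<Rightarrow> nat \<Rightarrow> nat \<Rightarrow> int" where
  "cubic_coeff q i j k = (if i + j + k = 3 * q
     then fact i * fact j * fact k * lookup (vandermonde ^ q) (exponent i j k) else 0)"

text \<open>The three-term relation expresses translation invariance of the Vandermonde polynomial.\<close>

lemma cubic_coeff_relation:
  "cubic_coeff q (Suc i) j k + cubic_coeff q i (Suc j) k + cubic_coeff q i j (Suc k) = 0"
proof -
  \<comment> \<open>Each factor is a difference of two variables, so the sum of its three partial
    derivatives is 0.\<close>
  have van: "pdiff 0 vandermonde + pdiff 1 vandermonde + pdiff 2 vandermonde = 0"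
    by (simp add: vandermonde_def pdiff_mult pdiff_diff pdiff_Var) (simp add: algebra_simps)
  have "pdiff 0 (vandermonde ^ q) + pdiff 1 (vandermonde ^ q) + pdiff 2 (vandermonde ^ q) = 0"
  proof (induction q)
    case 0
    then show ?case using pdiff_Const[of _ "1 :: int"] by (simp add: Const_1)
  next
    case (Suc q)
    have "pdiff 0 (vandermonde ^ Suc q) + pdiff 1 (vandermonde ^ Suc q) + pdiff 2 (vandermonde ^ Suc q)
        = (pdiff 0 vandermonde + pdiff 1 vandermonde + pdiff 2 vandermonde) * vandermonde ^ q
          + vandermonde * (pdiff 0 (vandermonde ^ q) + pdiff 1 (vandermonde ^ q) + pdiff 2 (vandermonde ^ q))"
      unfolding power_Suc pdiff_mult by (simp only: algebra_simps)
    then show ?case using Suc van by simp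
  qed
  then have "lookup (pdiff 0 (vandermonde ^ q) + pdiff 1 (vandermonde ^ q) + pdiff 2 (vandermonde ^ q)) (exponent i j k) = 0"
    by simp
  moreover have "exponent i j k + single 0 1 = exponent (Suc i) j k"
    "exponent i j k + single 1 1 = exponent i (Suc j) k"
    "exponent i j k + single 2 1 = exponent i j (Suc k)"
    using exponent_add[of i j k 1 0 0] exponent_add[of i j k 0 1 0] exponent_add[of i j k 0 0 1]
    by (simp_all add: exponent_def)
  moreover have "lookup (exponent i j k) 0 = i" "lookup (exponent i j k) 1 = j" "lookup (exponent i j k) 2 = k"
    by (simp_all add: exponent_def lookup_add lookup_single when_def)
  ultimately have *: "int (Suc i) * lookup (vandermonde ^ q) (exponent (Suc i) j k)
      + int (Suc j) * lookup (vandermonde ^ q) (exponent i (Suc j) k)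
      + int (Suc k) * lookup (vandermonde ^ q) (exponent i j (Suc k)) = 0"
    by (simp only: lookup_add lookup_pdiff)
  show ?thesis
  proof (cases "Suc (i + j + k) = 3 * q")
    case True
    \<comment> \<open>The factors \<open>Suc i\<close>, \<open>Suc j\<close>, \<open>Suc k\<close>
      from differentiation are absorbed into the factorials.\<close>
    then have "cubic_coeff q (Suc i) j k + cubic_coeff q i (Suc j) k + cubic_coeff q i j (Suc k)
        = fact i * fact j * fact k * (int (Suc i) * lookup (vandermonde ^ q) (exponent (Suc i) j k)
      + int (Suc j) * lookup (vandermonde ^ q) (exponent i (Suc j) k)
      + int (Suc k) * lookup (vandermonde ^ q) (exponent i j (Suc k)))"
      by (simp add: cubic_coeff_def algebra_simps)
    then show ?thesis by (simp only: * mult_zero_right)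
  qed (simp add: cubic_coeff_def)
qed

text \<open>By reciprocity every monomial of \<open>vandermonde ^ q\<close> divides the one with all
  exponents \<open>2 * q\<close>. For \<open>n = 2 * q\<close> this supplies the boundary conditions
  of \<open>cubic_in_An\<close>.\<close>

lemma cubic_coeff_eq_0:
  assumes "i > 2 * q \<or> j > 2 * q \<or> k > 2 * q"
  shows "cubic_coeff q i j k = 0"
proof -
  have "exponent i j k \<notin> keys (vandermonde ^ q)"
  proof
    assume in_keys: "exponent i j k \<in> keys (vandermonde ^ q)"
    obtain \<epsilon> where "reciprocal (exponent (2 * q) (2 * q) (2 * q)) \<epsilon> (vandermonde ^ q)"
      using reciprocal_vandermonde_power by blast
    then obtain \<nu> where "exponent i j k + \<nu> = exponent (2 * q) (2 * q) (2 * q)"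
      using in_keys by (auto simp: reciprocal_def)
    then have "lookup (exponent i j k + \<nu>) x = lookup (exponent (2 * q) (2 * q) (2 * q)) x" for x
      by simp
    from this[of 0] this[of 1] this[of 2] assms show False
      by (auto simp: exponent_def lookup_add lookup_single when_def)
  qed
  then show ?thesis by (simp add: cubic_coeff_def in_keys_iff)
qed

text \<open>Summation by parts: lowering the index of the variable raises that of the coefficient.
  The range closes at the bottom by \<open>D x_0 = 0\<close> and at the top by the
  assumption.\<close>

lemma sum_mult_weitz_Var:
  assumes "h (Suc n) = 0"
  shows "(\<Sum>i\<le>n. h i * weitz n (Var i)) = (\<Sum>i\<le>n. h (Suc i) * Var i)"
proof -
  have "(\<Sum>i\<le>n. h i * weitz n (Var i)) = (\<Sum>i<n. h (Suc i) * weitz n (Var (Suc i)))"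
    by (simp add: sum.atMost_shift weitz_Var)
  also have "\<dots> = (\<Sum>i<n. h (Suc i) * Var i)"
    by (intro sum.cong) (auto simp: weitz_Var)
  also have "\<dots> = (\<Sum>i\<le>n. h (Suc i) * Var i)"
    by (simp add: assms flip: lessThan_Suc_atMost)
  finally show ?thesis .
qed

text \<open>Shifting indices in each of the three factors makes the left-hand side of
  \<open>rel\<close> the coefficient of \<open>x_i x_j x_k\<close> in the derivative.\<close>

lemma cubic_in_An:
  fixes C :: "nat \<Rightarrow> nat \<Rightarrow> nat \<Rightarrow> 'a::field_char_0"
  assumes zero: "\<And>j k. C (Suc n) j k = 0" "\<And>i k. C i (Suc n) k = 0" "\<And>i j. C i j (Suc n) = 0"
    and rel: "\<And>i j k. C (Suc i) j k + C i (Suc j) k + C i j (Suc k) = 0"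
  shows "(\<Sum>i\<le>n. \<Sum>j\<le>n. \<Sum>k\<le>n. Const (C i j k) * (Var i * Var j * Var k)) \<in> An n"
proof -
  let ?w = "\<Sum>i\<le>n. \<Sum>j\<le>n. \<Sum>k\<le>n. Const (C i j k) * (Var i * Var j * Var k)"
  have "weitz n ?w = (\<Sum>i\<le>n. \<Sum>j\<le>n. \<Sum>k\<le>n. Const (C i j k) *
      (weitz n (Var i) * Var j * Var k + Var i * weitz n (Var j) * Var k + Var i * Var j * weitz n (Var k)))"
    by (simp only: weitz_sum weitz_Const_mult weitz_mult[of n "Var _"] weitz_mult[of n "Var _ * Var _"] distrib_right)
  also have "\<dots> = (\<Sum>i\<le>n. (\<Sum>j\<le>n. \<Sum>k\<le>n. Const (C i j k) * Var j * Var k) * weitz n (Var i))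
      + (\<Sum>i\<le>n. \<Sum>j\<le>n. (\<Sum>k\<le>n. Const (C i j k) * Var i * Var k) * weitz n (Var j))
      + (\<Sum>i\<le>n. \<Sum>j\<le>n. \<Sum>k\<le>n. (Const (C i j k) * Var i * Var j) * weitz n (Var k))"
    by (simp only: sum.distrib sum_distrib_right sum_distrib_left distrib_left mult_ac)
  also have "\<dots> = (\<Sum>i\<le>n. (\<Sum>j\<le>n. \<Sum>k\<le>n. Const (C (Suc i) j k) * Var j * Var k) * Var i)
      + (\<Sum>i\<le>n. \<Sum>j\<le>n. (\<Sum>k\<le>n. Const (C i (Suc j) k) * Var i * Var k) * Var j)
      + (\<Sum>i\<le>n. \<Sum>j\<le>n. \<Sum>k\<le>n. (Const (C i j (Suc k)) * Var i * Var j) * Var k)"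
    by (intro arg_cong2[where f = "(+)"] sum.cong refl sum_mult_weitz_Var) (simp_all add: zero)
  also have "\<dots> = (\<Sum>i\<le>n. \<Sum>j\<le>n. \<Sum>k\<le>n.
      Const (C (Suc i) j k + C i (Suc j) k + C i j (Suc k)) * (Var i * Var j * Var k))"
    by (simp only: Const_add sum.distrib sum_distrib_right sum_distrib_left distrib_left mult_ac)
  also have "\<dots> = 0" by (simp add: rel)
  finally show ?thesis
    by (auto simp: An_def intro!: Rn_intros)
qed

lemma extra_invariant_exists:
  assumes "n mod 4 = 0"
  shows "\<exists>w :: 'a::field_char_0 mpol. is_extra n w"
proof -
  define r where "r = n div 4"
  define q where "q = n div 2"
  have q: "q = 2 * r" "n = 2 * q" using assms unfolding q_def r_def by presburger+
  \<comment> \<open>The division normalises the coefficient of \<open>x_q ^ 3\<close> to 1. The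
    denominator is nonzero by \<open>central_coefficient_neq_0\<close>, as \<open>q\<close> is
    even.\<close>
  define C :: "nat \<Rightarrow> nat \<Rightarrow> nat \<Rightarrow> 'a" where
    "C i j k = of_int (cubic_coeff q i j k) / of_int (cubic_coeff q q q q)" for i j k
  define w where "w = (\<Sum>i\<le>n. \<Sum>j\<le>n. \<Sum>k\<le>n. Const (C i j k) * (Var i * Var j * Var k))"
  have "w \<in> An n"
    unfolding w_def
  proof (rule cubic_in_An)
    fix i j k
    show "C (Suc i) j k + C i (Suc j) k + C i j (Suc k) = 0"
      unfolding C_def add_divide_distrib[symmetric] of_int_add[symmetric] cubic_coeff_relation by simp
  qed (simp_all add: C_def cubic_coeff_eq_0 q(2))
  moreover have "proj (n div 2) n w = Var 0 ^ 3"
  proof -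
    define \<sigma> :: "nat \<Rightarrow> 'a mpol" where "\<sigma> i = (if i < q then 0 else Var (i - q))" for i
    have "cubic_coeff q q q q \<noteq> 0"
      using central_coefficient_neq_0[of r] by (simp add: cubic_coeff_def q(1))
    then have "C q q q = 1" by (simp add: C_def)
    have monomial: "Const (C i j k) * (\<sigma> i * \<sigma> j * \<sigma> k)
        = (if i = q then if j = q then if k = q then Var 0 ^ 3 else 0 else 0 else 0)" for i j k
    proof (cases "i = q \<and> j = q \<and> k = q")
      case True
      then show ?thesis using \<open>C q q q = 1\<close> by (simp add: \<sigma>_def Const_1 power3_eq_cube)
    next
      case False
      \<comment> \<open>Three indices that are at least \<open>q\<close> and have sum
        \<open>3 * q\<close> are all equal to \<open>q\<close>.\<close>
      then have "i < q \<or> j < q \<or> k < q \<or> i + j + k \<noteq> 3 * q" by linarith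
      then have "\<sigma> i = 0 \<or> \<sigma> j = 0 \<or> \<sigma> k = 0 \<or> C i j k = 0"
        by (auto simp: \<sigma>_def C_def cubic_coeff_def)
      then show ?thesis using False by auto
    qed
    have "proj (n div 2) n w = subst_hom Const \<sigma> w"
    proof -
      have "n - q = q" using q(2) by simp
      then show ?thesis unfolding proj_def \<sigma>_def[abs_def] q_def[symmetric] by (simp only:)
    qed
    also have "\<dots> = (\<Sum>i\<le>n. \<Sum>j\<le>n. \<Sum>k\<le>n. Const (C i j k) * (\<sigma> i * \<sigma> j * \<sigma> k))"
      unfolding w_def by (simp add: coefficient_hom.subst_simps[OF coefficient_hom_Const])
    also have "\<dots> = Var 0 ^ 3"
    proof -
      have "(\<Sum>k\<le>n. if P then g k else 0) = (if P then \<Sum>k\<le>n. g k else 0)"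
        for P and g :: "nat \<Rightarrow> 'a mpol" by simp
      then show ?thesis using q(2) by (simp add: monomial)
    qed
    finally show ?thesis .
  qed
  ultimately show ?thesis by (auto simp: is_extra_def)
qed

section \<open>Separation\<close>

text \<open>Every mixed product in \<open>f_inv m\<close> contains some \<open>x_k\<close> with
  \<open>k < m\<close>, so only the half square is left.\<close>

lemma eval_at_f_inv:
  fixes v :: "nat \<Rightarrow> 'a::field_char_0"
  assumes "\<And>k. k < m \<Longrightarrow> v k = 0"
  shows "eval_at v (f_inv m) = (if m = 0 then v 0 else (- 1) ^ m / 2 * v m ^ 2)"
proof -
  have sign: "eval_at v (- 1) = - 1"
    by (simp add: eval_at_uminus eval_at_simps)
  show ?thesis
  proof (cases "m = 0")
    case False
    then have "(\<Sum>k = 0..m - 1. eval_at v ((- 1) ^ k * Var k * Var (2 * m - k) :: 'a mpol)) = 0"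
      by (intro sum.neutral) (auto simp: eval_at_simps assms)
    with False show ?thesis
      by (simp add: f_inv_def eval_at_simps(3,8)) (simp add: eval_at_simps(4-7) sign)
  qed (simp add: f_inv_def eval_at_simps)
qed

lemma f_inv_zeros:
  fixes v :: "nat \<Rightarrow> 'a::field_char_0"
  assumes "\<And>k. k < m \<Longrightarrow> eval_at v (f_inv k) = 0" "j < m"
  shows "v j = 0"
  using assms(2)
proof (induction j rule: less_induct)
  case (less j)
  then show ?case
    using eval_at_f_inv[of j v] assms(1)[of j] by (auto split: if_splits)
qed

lemma En_subset_An:
  assumes "n \<ge> 1" "n mod 4 = 0 \<longrightarrow> is_extra n w"
  shows "En n w \<subseteq> An n"
  using assms by (auto simp: En_def is_extra_def f_inv_in_An eps_in_An split: if_splits)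

text \<open>On points whose first \<open>q\<close> coordinates vanish, \<open>w\<close> factors
  through the projection: its value is that of \<open>proj q n w\<close> at the point with these
  zeros dropped.\<close>

lemma eval_at_extra:
  fixes v :: "nat \<Rightarrow> 'a::field_char_0"
  assumes "is_extra n w" "n = 2 * q" "\<And>i. i < q \<Longrightarrow> v i = 0"
  shows "eval_at v w = v q ^ 3"
proof -
  have n: "n div 2 = q" "n - q = q" using assms(2) by simp_all
  have "eval_at u (subst_hom Const \<sigma> p) = eval_at (\<lambda>i. eval_at u (\<sigma> i)) p" if "p \<in> Rn n"
    for u \<sigma> and p :: "'a mpol"
    using that
    by (induction rule: Rn_induct) (simp_all add: coefficient_hom.subst_simps[OF coefficient_hom_Const] eval_at_simps)
  moreover have "w \<in> Rn n" using assms(1) by (simp add: is_extra_def An_def)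
  ultimately have "eval_at (\<lambda>i. v (i + q)) (proj q n w)
      = eval_at (\<lambda>i. eval_at (\<lambda>i. v (i + q)) (if i < q then 0 else Var (i - q))) w"
    unfolding proj_def n by blast
  also have "(\<lambda>i. eval_at (\<lambda>i. v (i + q)) (if i < q then 0 else Var (i - q))) = v"
    by (auto simp: eval_at_simps assms(3))
  finally show ?thesis
    using assms(1) by (simp add: is_extra_def n eval_at_simps)
qed

lemma En_separates:
  fixes w f :: "'a::field_char_0 mpol"
  assumes n: "n \<ge> 1" and w: "n mod 4 = 0 \<longrightarrow> is_extra n w" and f: "f \<in> An n"
    and eq: "\<And>s. s \<in> En n w \<Longrightarrow> eval_at v s = eval_at v' s"
  shows "eval_at v f = eval_at v' f"
proof -
  have eq_f: "eval_at v (f_inv m) = eval_at v' (f_inv m)" if "m \<le> n div 2" for m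
    using that by (intro eq) (auto simp: En_def)
  show ?thesis
  proof (cases "\<exists>m. m \<le> (n - 1) div 2 \<and> eval_at v (f_inv m) \<noteq> 0")
    case True
    define m where "m = (LEAST m. m \<le> (n - 1) div 2 \<and> eval_at v (f_inv m) \<noteq> 0)"
    have m: "m \<le> (n - 1) div 2" "eval_at v (f_inv m) \<noteq> 0"
      using LeastI_ex[OF True] by (simp_all add: m_def)
    have "(n - 1) div 2 \<le> n div 2" by (simp add: div_le_mono)
    then have m_le: "m \<le> n div 2" using m(1) by simp
    have "eval_at v (f_inv k) = 0" if "k < m" for k
      using not_less_Least[of k "\<lambda>m. m \<le> (n - 1) div 2 \<and> eval_at v (f_inv m) \<noteq> 0"] that m(1)
      by (auto simp: m_def)
    moreover from this have "eval_at v' (f_inv k) = 0" if "k < m" for k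
      using eq_f[of k] m_le that by simp
    ultimately have zeros: "v k = 0" "v' k = 0" if "k < m" for k
      using f_inv_zeros[of m] that by blast+
    note D = weitz_s_slice[OF n m(1), where 'a = 'a]
    show ?thesis
    proof (rule slice_separates[OF f])
      show "eval_at v (weitz n (s_slice m)) = eval_at v (f_inv m)"
        "eval_at v' (weitz n (s_slice m)) = eval_at v (f_inv m)"
        using eq_f[OF m_le] by (simp_all add: D)
      show "eval_at v (eps n (s_slice m) (Var i)) = eval_at v' (eps n (s_slice m) (Var i))" if i: "i \<le> n" for i
      proof -
        \<comment> \<open>Some of these indices are missing from \<open>En n w\<close>. For
          \<open>i < m\<close> every coordinate involved is 0. For \<open>m = 0\<close>,
          \<open>eps\<close> sends \<open>x_0\<close> to \<open>x_0 = f_0\<close> and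
          \<open>x_1\<close> to \<open>x_1 x_0 - x_0 x_1 = 0\<close>.\<close>
        consider "i < m" | "m = 0" "i = 0" | "m = 0" "i = 1" | "m = 0" "i \<ge> 2" | "m \<ge> 1" "i \<ge> m"
          by linarith
        then show ?thesis
        proof cases
          case 1
          then have "eval_at u (eps n (s_slice m) (Var i)) = 0" if "\<And>k. k < m \<Longrightarrow> u k = 0" for u :: "nat \<Rightarrow> 'a"
            unfolding eps_Var[OF i] by (auto simp: eval_at_simps that intro!: sum.neutral)
          then show ?thesis using zeros by metis
        next
          case 2
          then show ?thesis
            using eq_f[of 0] unfolding eps_Var[OF i] by (simp add: eval_at_simps f_inv_def)
        next
          case 3
          then show ?thesis
            using D unfolding eps_Var[OF i] by (simp add: eval_at_simps f_inv_def s_slice_def)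
        next
          case 4
          then show ?thesis using i by (intro eq) (auto simp: En_def)
        next
          case 5
          then show ?thesis using i m(1) by (intro eq) (auto simp: En_def)
        qed
      qed
    qed (rule m(2))
  next
    case False
    have "eval_at v (f_inv m) = 0" "eval_at v' (f_inv m) = 0" if "m \<le> (n - 1) div 2" for m
      using False eq_f[of m] that by (auto simp: div_le_mono)
    then have zeros: "v i = 0" "v' i = 0" if "2 * i < n" for i
      using f_inv_zeros[of "Suc ((n - 1) div 2)" v i] f_inv_zeros[of "Suc ((n - 1) div 2)" v' i] that
      by (auto simp: less_Suc_eq_le)
    \<comment> \<open>The point to which middle coordinate \<open>c\<close> degenerates; for odd
      \<open>n\<close> it is the origin whatever \<open>c\<close> is.\<close>
    define mid where "mid c = (\<lambda>i. if 2 * i = n then (- 1) ^ i * c else (0::'a))" for c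
    have degenerate: "eval_at u f = eval_at (mid (u (n div 2))) f" if "\<And>i. 2 * i < n \<Longrightarrow> u i = 0" for u
    proof -
      have "mid (u (n div 2)) = (\<lambda>i. if 2 * i = n then (- 1) ^ i * u i else 0)"
        by (rule ext) (auto simp: mid_def)
      with eval_at_degeneration[OF f that] show ?thesis by simp
    qed
    show ?thesis
    proof (cases "even n")
      case False
      then have "mid c = mid c'" for c c' by (intro ext) (auto simp: mid_def)
      then show ?thesis using degenerate[of v] degenerate[of v'] zeros by metis
    next
      case True
      then obtain q where q: "n = 2 * q" by blast
      have sq: "v q ^ 2 = v' q ^ 2"
        using eq_f[of q] eval_at_f_inv[of q v] eval_at_f_inv[of q v'] zeros q n by auto
      show ?thesis
      proof (cases "n mod 4 = 0")
        case True
        then have "w \<in> En n w" by (simp add: En_def)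
        then have cube: "v q ^ 3 = v' q ^ 3"
          using eval_at_extra[of n w q] w True q zeros eq[of w] by simp
        have "v q = v' q"
        proof (cases "v q = 0")
          case False
          have "v q ^ 2 * v q = v q ^ 2 * v' q"
            using cube sq by (simp add: power3_eq_cube power2_eq_square)
          with False show ?thesis by simp
        qed (use sq in simp)
        then show ?thesis using degenerate[of v] degenerate[of v'] zeros q by simp
      next
        case False
        then have "odd q" using q by presburger
        \<comment> \<open>For odd \<open>q\<close> the middle coordinate of \<open>mid c\<close> is
          \<open>- c\<close>. Degenerating a second time shows that invariants cannot tell
          \<open>c\<close> from \<open>- c\<close>, so knowing the square of \<open>v q\<close>
          suffices.\<close>
        then have "mid (mid c q) = mid (- c)" for c using q by (auto simp: mid_def)
        moreover have "eval_at (mid c) f = eval_at (mid (mid c q)) f" for c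
          using degenerate[of "mid c"] q by (simp add: mid_def)
        ultimately have "eval_at (mid c) f = eval_at (mid (- c)) f" for c by metis
        moreover have "v' q = v q \<or> v' q = - v q" using sq by (metis power2_eq_iff)
        ultimately have "eval_at (mid (v q)) f = eval_at (mid (v' q)) f" by metis
        then show ?thesis using degenerate[of v] degenerate[of v'] zeros q by simp
      qed
    qed
  qed
qed

theorem theorem2p1:
  fixes n :: nat
  assumes "n \<ge> 1"
  shows "(n mod 4 = 0 \<longrightarrow> (\<exists>w :: 'a::field_char_0 mpol. is_extra n w)) \<and>
         (\<forall>w :: 'a mpol. (n mod 4 = 0 \<longrightarrow> is_extra n w) \<longrightarrow> separating_set n (En n w))"
proof (intro conjI impI allI)
  show "\<exists>w :: 'a mpol. is_extra n w" if "n mod 4 = 0"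
    using that by (rule extra_invariant_exists)
  show "separating_set n (En n w)" if "n mod 4 = 0 \<longrightarrow> is_extra n w" for w :: "'a mpol"
    unfolding separating_set_def
    using En_subset_An[OF assms that] En_separates[OF assms that] by blast
qed

end
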